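(* Let $\Omega=(0,1)\times(0,1)\subset\mathbb{R}^2$ and let $h:[0,1]\to\mathbb{R}$ be a bounded function with $h(0)=0$, $h(x_1)>0$ for $x_1\in(0,1]$, $h\in C^1(0,1]$, and suppose there exist constants $C>0$ and $\theta\in(0,1)$ such that $$\sup_{x\in\Omega,\ 0<r\le d}\frac{\int_{B(x,r)\cap\Omega}h(x_1)^{-1}\,dx}{|B(x,r)\cap\Omega|^{\theta}}\le C,$$ where $d$ is the diameter of $\Omega$. Then the embedding $\mathcal{H}_{h,0}^1(\Omega)\hookrightarrow L^2(\Omega)$ is compact.
   Context: $B(x,r)$ is the Euclidean ball with center $x$ and radius $r$, $|\cdot|$ is Lebesgue measure. $\mathcal{H}_h^1(\Omega)=\{u\in L^2(\Omega)\mid \partial_{x_1}u\in L^2(\Omega),\ \sqrt{h(x_1)}\,\partial_{x_2}u\in L^2(\Omega)\}$ (distributional derivatives), with norm $\|u\|_{\mathcal{H}_h^1(\Omega)}=\big(\|u\|_{L^2(\Omega)}^2+\|\partial_{x_1}u\|_{L^2(\Omega)}^2+\|\sqrt{h(x_1)}\partial_{x_2}u\|_{L^2(\Omega)}^2\big)^{1/2}$. $\mathcal{H}_{h,0}^1(\Omega)$ is the closure of $C_0^\infty(\Omega)$ in $\mathcal{H}_h^1(\Omega)$. *)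

theory Defs
  imports "HOL-Analysis.Analysis"
begin

text \<open>Points of the plane are pairs (x1, x2); the product metric is Euclidean.\<close>

definition Omega :: "(real \<times> real) set" where
  "Omega = {0<..<1} \<times> {0<..<1}"

definition pd1 :: "(real \<times> real \<Rightarrow> real) \<Rightarrow> real \<times> real \<Rightarrow> real" where
  "pd1 f x = frechet_derivative f (at x) (1, 0)"

definition pd2 :: "(real \<times> real \<Rightarrow> real) \<Rightarrow> real \<times> real \<Rightarrow> real" where
  "pd2 f x = frechet_derivative f (at x) (0, 1)"

coinductive smooth_R2 :: "(real \<times> real \<Rightarrow> real) \<Rightarrow> bool" where
  "\<lbrakk> \<forall>x. f differentiable (at x); smooth_R2 (pd1 f); smooth_R2 (pd2 f) \<rbrakk> \<Longrightarrow> smooth_R2 f"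

definition test_fun :: "(real \<times> real) set \<Rightarrow> (real \<times> real \<Rightarrow> real) \<Rightarrow> bool" where
  "test_fun U \<phi> \<longleftrightarrow> smooth_R2 \<phi> \<and> compact (closure {x. \<phi> x \<noteq> 0})
      \<and> closure {x. \<phi> x \<noteq> 0} \<subseteq> U"

definition L2 :: "(real \<times> real) set \<Rightarrow> (real \<times> real \<Rightarrow> real) \<Rightarrow> bool" where
  "L2 U u \<longleftrightarrow> u \<in> borel_measurable (lebesgue_on U)
      \<and> integrable (lebesgue_on U) (\<lambda>x. (u x)\<^sup>2)"

definition loc_int :: "(real \<times> real) set \<Rightarrow> (real \<times> real \<Rightarrow> real) \<Rightarrow> bool" where
  "loc_int U u \<longleftrightarrow> (\<forall>K. compact K \<and> K \<subseteq> U \<longrightarrow> integrable (lebesgue_on K) u)"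

definition weak_deriv ::
  "(real \<times> real) set \<Rightarrow> ((real \<times> real \<Rightarrow> real) \<Rightarrow> real \<times> real \<Rightarrow> real)
     \<Rightarrow> (real \<times> real \<Rightarrow> real) \<Rightarrow> (real \<times> real \<Rightarrow> real) \<Rightarrow> bool" where
  "weak_deriv U D u g \<longleftrightarrow> loc_int U u \<and> loc_int U g \<and>
     (\<forall>\<phi>. test_fun U \<phi> \<longrightarrow>
        (\<integral>x. u x * D \<phi> x \<partial>lebesgue_on U) = - (\<integral>x. g x * \<phi> x \<partial>lebesgue_on U))"

definition H1h :: "(real \<Rightarrow> real) \<Rightarrow> (real \<times> real \<Rightarrow> real) \<Rightarrow> (real \<times> real \<Rightarrow> real)
     \<Rightarrow> (real \<times> real \<Rightarrow> real) \<Rightarrow> bool" where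
  "H1h h u g1 g2 \<longleftrightarrow> L2 Omega u \<and> weak_deriv Omega pd1 u g1 \<and> L2 Omega g1
      \<and> weak_deriv Omega pd2 u g2 \<and> L2 Omega (\<lambda>x. sqrt (h (fst x)) * g2 x)"

definition Hnorm2 :: "(real \<Rightarrow> real) \<Rightarrow> (real \<times> real \<Rightarrow> real) \<Rightarrow> (real \<times> real \<Rightarrow> real)
     \<Rightarrow> (real \<times> real \<Rightarrow> real) \<Rightarrow> real" where
  "Hnorm2 h u g1 g2 = (\<integral>x. (u x)\<^sup>2 \<partial>lebesgue_on Omega) + (\<integral>x. (g1 x)\<^sup>2 \<partial>lebesgue_on Omega)
      + (\<integral>x. (sqrt (h (fst x)) * g2 x)\<^sup>2 \<partial>lebesgue_on Omega)"

definition H0 :: "(real \<Rightarrow> real) \<Rightarrow> (real \<times> real \<Rightarrow> real) \<Rightarrow> bool" where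
  "H0 h u \<longleftrightarrow> (\<exists>g1 g2. H1h h u g1 g2 \<and>
     (\<exists>\<phi>. (\<forall>n. test_fun Omega (\<phi> n)) \<and>
        (\<lambda>n. Hnorm2 h (\<lambda>x. \<phi> n x - u x) (\<lambda>x. pd1 (\<phi> n) x - g1 x) (\<lambda>x. pd2 (\<phi> n) x - g2 x))
          \<longlonglongrightarrow> 0))"

definition compact_embedding_H0_L2 :: "(real \<Rightarrow> real) \<Rightarrow> bool" where
  "compact_embedding_H0_L2 h \<longleftrightarrow>
     (\<forall>(u::nat \<Rightarrow> real \<times> real \<Rightarrow> real) g1 g2 (M::real).
        (\<forall>n. H0 h (u n) \<and> H1h h (u n) (g1 n) (g2 n) \<and> Hnorm2 h (u n) (g1 n) (g2 n) \<le> M)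
        \<longrightarrow> (\<exists>r v. strict_mono r \<and> L2 Omega v \<and>
               (\<lambda>n. \<integral>x. (u (r n) x - v x)\<^sup>2 \<partial>lebesgue_on Omega) \<longlonglongrightarrow> 0))"

end

theory Submission
  imports Defs "HOL-Complex_Analysis.Great_Picard"
begin

text \<open>Approximate the bounded sequence in \<open>L\<^sup>2\<close> by test functions that are bounded in the
  \<open>H\<^sup>1\<^sub>h\<close> norm. A test function \<open>f\<close> vanishes at \<open>x\<^sub>1 = 0\<close>, so its \<open>L\<^sup>2\<close> mass
  in the strip \<open>x\<^sub>1 \<le> \<delta>\<close> is at most \<open>\<delta>\<^sup>2\<close> times that of \<open>\<partial>\<^sub>1 f\<close>. On \<open>x\<^sub>1 \<ge> \<delta>\<close> the
  continuous weight \<open>h\<close> is bounded below by a positive constant, and the Poincare inequality on the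
  squares of a fine grid bounds the rest by the finitely many cell integrals of \<open>f\<close> and a small
  multiple of the energy. Passing to a subsequence along which all cell integrals of all grids
  converge therefore gives a Cauchy sequence in \<open>L\<^sup>2\<close>.\<close>

section \<open>Smooth functions and test functions\<close>

text \<open>The weight may degenerate at x1 = 0, so control of the x2-derivative is lost there. The
  x1-derivative carries no weight, and it alone handles the strip. Constants are fixed in a definite
  order: the strip width \<open>1 / real K\<close>, then the minimum of \<open>h\<close> on
  \<open>{1 / real K..1}\<close>, and only then the mesh, taken as \<open>K * m\<close> so that the
  edge of the strip is a grid line. As the mesh depends on that minimum, the subsequence is
  extracted beforehand and serves every grid at once. A second obstacle is that membership in
  \<open>H0\<close> supplies its own pair of weak derivatives, which need not be the pair in whose
  norm the sequence is bounded. The bound is carried from one pair to the other by orthogonality: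
  the difference of two weak derivatives annihilates test functions, and the derivatives of the
  approximants are themselves test functions. Working with test functions makes every inequality a
  classical one, obtained from the fundamental theorem of calculus along horizontal and vertical
  segments.\<close>

lemma smooth_R2_differentiable: "smooth_R2 f \<Longrightarrow> f differentiable (at x)"
  by (auto elim: smooth_R2.cases)

lemma smooth_R2_pd1: "smooth_R2 f \<Longrightarrow> smooth_R2 (pd1 f)"
  by (auto elim: smooth_R2.cases)

lemma smooth_R2_pd2: "smooth_R2 f \<Longrightarrow> smooth_R2 (pd2 f)"
  by (auto elim: smooth_R2.cases)

lemma smooth_R2_has_derivative:
  "smooth_R2 f \<Longrightarrow> (f has_derivative frechet_derivative f (at x)) (at x)"
  using smooth_R2_differentiable frechet_derivative_works by blast

lemma smooth_R2_continuous_on: "smooth_R2 f \<Longrightarrow> continuous_on S f"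
  by (meson continuous_at_imp_continuous_on differentiable_imp_continuous_within
      smooth_R2_differentiable)

lemma pd_eqI:
  assumes "(f has_derivative f') (at x)"
  shows "pd1 f x = f' (1, 0)" "pd2 f x = f' (0, 1)"
  using frechet_derivative_at[OF assms] by (simp_all add: pd1_def pd2_def)

lemma pd_add:
  assumes "smooth_R2 f" "smooth_R2 g"
  shows "pd1 (\<lambda>x. f x + g x) = (\<lambda>x. pd1 f x + pd1 g x)"
    "pd2 (\<lambda>x. f x + g x) = (\<lambda>x. pd2 f x + pd2 g x)"
  using pd_eqI[OF has_derivative_add[OF assms[THEN smooth_R2_has_derivative]]]
  by (auto simp: pd1_def pd2_def)

lemma smooth_R2_add:
  assumes "smooth_R2 f" "smooth_R2 g"
  shows "smooth_R2 (\<lambda>x. f x + g x)"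
proof -
  \<comment> \<open>The coinduction invariant is being a sum of two smooth functions; linearity of
    \<open>pd1\<close> and \<open>pd2\<close> makes it stable under both.\<close>
  have "\<exists>f g. smooth_R2 f \<and> smooth_R2 g \<and> (\<lambda>x. f x + g x) = F \<Longrightarrow> smooth_R2 F" for F
  proof (coinduction arbitrary: F)
    case smooth_R2
    then obtain f g where fg: "smooth_R2 f" "smooth_R2 g" and F: "F = (\<lambda>x. f x + g x)"
      by auto
    have "\<forall>x. F differentiable (at x)"
      unfolding F using fg by (auto intro: differentiable_add smooth_R2_differentiable)
    moreover have "pd1 F = (\<lambda>x. pd1 f x + pd1 g x)" "pd2 F = (\<lambda>x. pd2 f x + pd2 g x)"
      unfolding F by (rule pd_add[OF fg])+
    ultimately show ?case
      using fg(1) fg[THEN smooth_R2_pd1] fg[THEN smooth_R2_pd2] by auto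
  qed
  then show ?thesis using assms by blast
qed

lemma pd_cmult:
  assumes "smooth_R2 f"
  shows "pd1 (\<lambda>x. c * f x) = (\<lambda>x. c * pd1 f x)" "pd2 (\<lambda>x. c * f x) = (\<lambda>x. c * pd2 f x)"
  using pd_eqI[OF has_derivative_mult_right[OF smooth_R2_has_derivative[OF assms], of c]]
  by (auto simp: pd1_def pd2_def)

lemma smooth_R2_cmult:
  assumes "smooth_R2 f"
  shows "smooth_R2 (\<lambda>x. c * f x)"
proof -
  have "\<exists>f. smooth_R2 f \<and> (\<lambda>x. c * f x) = F \<Longrightarrow> smooth_R2 F" for F
  proof (coinduction arbitrary: F)
    case smooth_R2
    then obtain f where f: "smooth_R2 f" and F: "F = (\<lambda>x. c * f x)"
      by auto
    have "\<forall>x. F differentiable (at x)"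
      unfolding F using f by (auto intro: differentiable_mult smooth_R2_differentiable)
    moreover have "pd1 F = (\<lambda>x. c * pd1 f x)" "pd2 F = (\<lambda>x. c * pd2 f x)"
      unfolding F by (rule pd_cmult[OF f])+
    ultimately show ?case
      using f[THEN smooth_R2_pd1] f[THEN smooth_R2_pd2] by auto
  qed
  then show ?thesis using assms by blast
qed

lemma smooth_R2_diff:
  "smooth_R2 f \<Longrightarrow> smooth_R2 g \<Longrightarrow> smooth_R2 (\<lambda>x. f x - g x)"
  using smooth_R2_add[OF _ smooth_R2_cmult[of g "-1"]] by simp

lemma pd_diff:
  assumes "smooth_R2 f" "smooth_R2 g"
  shows "pd1 (\<lambda>x. f x - g x) = (\<lambda>x. pd1 f x - pd1 g x)"
    "pd2 (\<lambda>x. f x - g x) = (\<lambda>x. pd2 f x - pd2 g x)"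
  using pd_add[OF assms(1) smooth_R2_cmult[OF assms(2), of "-1"]] pd_cmult[OF assms(2), of "-1"]
  by simp_all

lemma smooth_R2_fst_mult:
  assumes "smooth_R2 f"
  shows "smooth_R2 (\<lambda>x. fst x * f x)"
proof -
  \<comment> \<open>The extra summand \<open>g\<close> is needed for a stable invariant: by the
    product rule, \<open>pd1\<close> of the product leaves an additional \<open>f\<close>. The claim
    is the case \<open>g = 0\<close>.\<close>
  have "\<exists>f g. smooth_R2 f \<and> smooth_R2 g \<and> (\<lambda>x. fst x * f x + g x) = F \<Longrightarrow> smooth_R2 F" for F
  proof (coinduction arbitrary: F)
    case smooth_R2
    then obtain f g where fg: "smooth_R2 f" "smooth_R2 g" and F: "F = (\<lambda>x. fst x * f x + g x)"
      by auto
    have der: "(F has_derivative (\<lambda>v. fst x * frechet_derivative f (at x) v + fst v * f x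
        + frechet_derivative g (at x) v)) (at x)" for x
      unfolding F
      by (intro has_derivative_add has_derivative_mult smooth_R2_has_derivative fg
          has_derivative_fst has_derivative_ident)
    have "pd1 F = (\<lambda>x. fst x * pd1 f x + (f x + pd1 g x))"
      "pd2 F = (\<lambda>x. fst x * pd2 f x + pd2 g x)"
      using pd_eqI[OF der] by (auto simp: pd1_def pd2_def)
    moreover have "smooth_R2 (\<lambda>x. f x + pd1 g x)"
      by (intro smooth_R2_add smooth_R2_pd1 fg)
    moreover have "\<forall>x. F differentiable (at x)"
      using der differentiable_def by blast
    ultimately show ?case
      using fg(1) fg[THEN smooth_R2_pd1] fg[THEN smooth_R2_pd2] by auto
  qed
  moreover have "smooth_R2 (\<lambda>x. 0)"
    using smooth_R2_cmult[OF assms, of 0] by simp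
  moreover have "(\<lambda>x. fst x * f x + 0) = (\<lambda>x. fst x * f x)"
    by simp
  ultimately show ?thesis
    using assms by blast
qed

text \<open>Induction on the polynomial with \<open>f\<close> arbitrary, so that a product of
  polynomials is absorbed one factor at a time. Its purpose is to approximate the merely continuous
  weight by factors that preserve test functions.\<close>

lemma smooth_R2_polynomial_mult:
  assumes "real_polynomial_function p" "smooth_R2 f"
  shows "smooth_R2 (\<lambda>x. p (fst x) * f x)"
  using assms
proof (induction arbitrary: f)
  case (linear l)
  interpret bounded_linear l by fact
  have "l t = l 1 * t" for t
    using scaleR[of t 1] by simp
  then have "(\<lambda>x. l (fst x) * f x) = (\<lambda>x. l 1 * (fst x * f x))"
    by (metis mult.assoc)
  then show ?case
    using smooth_R2_cmult[OF smooth_R2_fst_mult[OF linear.prems]] by simp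
next
  case (const c)
  then show ?case by (rule smooth_R2_cmult)
next
  case (add p q)
  then show ?case
    using smooth_R2_add[OF add.IH] by (simp add: distrib_right)
next
  case (mult p q)
  then show ?case
    by (simp add: mult.assoc)
qed

lemma test_fun_smooth: "test_fun U f \<Longrightarrow> smooth_R2 f"
  by (simp add: test_fun_def)

text \<open>The inclusion is into the closure because a derivative of \<open>f\<close> may be
  nonzero at a zero of \<open>f\<close>.\<close>

lemma test_fun_support_subset:
  assumes "test_fun U f" "smooth_R2 g" "{x. g x \<noteq> 0} \<subseteq> closure {x. f x \<noteq> 0}"
  shows "test_fun U g"
proof -
  have "closure {x. g x \<noteq> 0} \<subseteq> closure {x. f x \<noteq> 0}"
    using assms(3) by (simp add: closure_minimal)
  then show ?thesis
    using assms(1,2) unfolding test_fun_def compact_eq_bounded_closed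
    by (auto intro: bounded_subset)
qed

lemma pd_eq_0_off_support:
  assumes "x \<notin> closure {x. f x \<noteq> 0}"
  shows "pd1 f x = 0" "pd2 f x = 0"
proof -
  let ?U = "- closure {x. f x \<noteq> 0}"
  have z: "f y = 0" if "y \<in> ?U" for y
    using that closure_subset[of "{x. f x \<noteq> 0}"] by auto
  have "open ?U" "x \<in> ?U"
    using assms by auto
  then have "(f has_derivative (\<lambda>_. 0)) (at x)"
    by (rule has_derivative_transform_within_open[OF has_derivative_const[of 0]])
       (rule z[symmetric])
  then show "pd1 f x = 0" "pd2 f x = 0"
    by (rule pd_eqI)+
qed

lemma test_fun_pd:
  assumes "test_fun U f"
  shows "test_fun U (pd1 f)" "test_fun U (pd2 f)"
  using assms pd_eq_0_off_support[of _ f]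
  by (intro test_fun_support_subset[OF assms]; auto intro: smooth_R2_pd1 smooth_R2_pd2 test_fun_smooth)+

lemma test_fun_polynomial_mult:
  assumes "real_polynomial_function p" "test_fun U f"
  shows "test_fun U (\<lambda>x. p (fst x) * f x)"
  using closure_subset[of "{x. f x \<noteq> 0}"]
  by (intro test_fun_support_subset[OF assms(2)])
     (auto intro: smooth_R2_polynomial_mult assms test_fun_smooth)

lemma test_fun_diff:
  assumes "test_fun U f" "test_fun U g"
  shows "test_fun U (\<lambda>x. f x - g x)"
proof -
  have "closure {x. f x - g x \<noteq> 0} \<subseteq> closure {x. f x \<noteq> 0} \<union> closure {x. g x \<noteq> 0}"
    unfolding closure_Un[symmetric] by (rule closure_mono) auto
  moreover have "compact (closure {x. f x \<noteq> 0} \<union> closure {x. g x \<noteq> 0})"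
    using assms by (auto simp: test_fun_def)
  ultimately show ?thesis
    using assms smooth_R2_diff[of f g] unfolding test_fun_def compact_eq_bounded_closed
    by (blast intro: bounded_subset closed_closure)
qed

lemma test_fun_eq_0: "test_fun U f \<Longrightarrow> x \<notin> U \<Longrightarrow> f x = 0"
  using closure_subset[of "{x. f x \<noteq> 0}"] by (auto simp: test_fun_def)

lemma pd_has_real_derivative:
  assumes "smooth_R2 f"
  shows "((\<lambda>s. f (s, y)) has_real_derivative pd1 f (x, y)) (at x within S)"
    "((\<lambda>t. f (x, t)) has_real_derivative pd2 f (x, y)) (at y within S)"
proof -
  let ?D = "frechet_derivative f (at (x, y))"
  have D: "(f has_derivative ?D) (at (x, y))"
    by (rule smooth_R2_has_derivative[OF assms])
  interpret bounded_linear ?D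
    using D by (rule has_derivative_bounded_linear)
  have "((\<lambda>s. (s, y)) has_derivative (\<lambda>s. (s, 0))) (at x within S)"
    by (intro derivative_intros)
  from has_derivative_compose[OF this D]
  have "((\<lambda>s. f (s, y)) has_derivative (\<lambda>s. ?D (s, 0))) (at x within S)" .
  moreover have "?D (s, 0) = pd1 f (x, y) * s" for s
    using scaleR[of s "(1, 0)"] by (simp add: pd1_def)
  ultimately show "((\<lambda>s. f (s, y)) has_real_derivative pd1 f (x, y)) (at x within S)"
    by (simp add: has_field_derivative_def)
  have "((\<lambda>s. (x, s)) has_derivative (\<lambda>s. (0, s))) (at y within S)"
    by (intro derivative_intros)
  from has_derivative_compose[OF this D]
  have "((\<lambda>s. f (x, s)) has_derivative (\<lambda>s. ?D (0, s))) (at y within S)" .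
  moreover have "?D (0, s) = pd2 f (x, y) * s" for s
    using scaleR[of s "(0, 1)"] by (simp add: pd2_def)
  ultimately show "((\<lambda>t. f (x, t)) has_real_derivative pd2 f (x, y)) (at y within S)"
    by (simp add: has_field_derivative_def)
qed

section \<open>Grid estimate\<close>

text \<open>Cauchy-Schwarz for the fundamental theorem of calculus, in a form symmetric in
  \<open>x\<close> and \<open>y\<close> and with the integral enlarged to the whole
  interval.\<close>

lemma square_diff_le_integral_deriv:
  fixes f :: "real \<Rightarrow> real"
  assumes der: "\<And>t. t \<in> {a..b} \<Longrightarrow> (f has_real_derivative f' t) (at t within {a..b})"
    and cont: "continuous_on {a..b} f'" and xy: "x \<in> {a..b}" "y \<in> {a..b}"
  shows "(f x - f y)\<^sup>2 \<le> (b - a) * integral {a..b} (\<lambda>t. (f' t)\<^sup>2)"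
proof -
  have *: "(f y - f x)\<^sup>2 \<le> (b - a) * integral {a..b} (\<lambda>t. (f' t)\<^sup>2)"
    if le: "x < y" and x: "x \<in> {a..b}" and y: "y \<in> {a..b}" for x y
  proof -
    have sub: "{x..y} \<subseteq> {a..b}" using x y by auto
    note c = continuous_on_subset[OF cont sub]
    \<comment> \<open>The mean slope. Integrating \<open>0 \<le> (k - f' t)\<^sup>2\<close> over
      \<open>{x..y}\<close> with this \<open>k\<close> yields Cauchy-Schwarz against a
      constant.\<close>
    define k where "k = (f y - f x) / (y - x)"
    have D: "f y - f x = k * (y - x)"
      using le by (simp add: k_def)
    have "(f' has_integral (f y - f x)) {x..y}"
    proof (rule fundamental_theorem_of_calculus)
      show "(f has_vector_derivative f' t) (at t within {x..y})" if "t \<in> {x..y}" for t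
        using DERIV_subset[OF der sub, of t] that sub
        by (auto simp: has_real_derivative_iff_has_vector_derivative)
    qed (use le in simp)
    then have "((\<lambda>t. 2 * k * f' t - k\<^sup>2) has_integral (2 * k * (f y - f x) - k\<^sup>2 * (y - x))) {x..y}"
      using le has_integral_const_real[of "k\<^sup>2" x y]
      by (intro has_integral_diff has_integral_mult_right) (auto simp: algebra_simps)
    moreover have int: "(\<lambda>t. (f' t)\<^sup>2) integrable_on {x..y}" "(\<lambda>t. (f' t)\<^sup>2) integrable_on {a..b}"
      by (intro integrable_continuous_real continuous_intros c cont)+
    ultimately have "2 * k * (f y - f x) - k\<^sup>2 * (y - x) \<le> integral {x..y} (\<lambda>t. (f' t)\<^sup>2)"
    proof (intro has_integral_le[OF _ integrable_integral[OF int(1)]])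
      show "2 * k * f' t - k\<^sup>2 \<le> (f' t)\<^sup>2" for t
        using zero_le_power2[of "k - f' t"] by (simp add: power2_diff algebra_simps)
    qed
    also have "2 * k * (f y - f x) - k\<^sup>2 * (y - x) = k\<^sup>2 * (y - x)"
      by (simp add: D power2_eq_square)
    finally have "(y - x) * (k\<^sup>2 * (y - x)) \<le> (y - x) * integral {x..y} (\<lambda>t. (f' t)\<^sup>2)"
      using le by (intro mult_left_mono) auto
    also have "\<dots> \<le> (b - a) * integral {a..b} (\<lambda>t. (f' t)\<^sup>2)"
      using le x y int sub
      by (intro mult_mono integral_subset_le integral_nonneg) auto
    finally show ?thesis
      by (simp add: D power2_eq_square mult_ac)
  qed
  consider "x < y" | "x = y" | "y < x" by linarith
  then show ?thesis
  proof cases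
    case 2
    have "0 \<le> integral {a..b} (\<lambda>t. (f' t)\<^sup>2)"
      by (intro integral_nonneg integrable_continuous_real continuous_intros cont) auto
    then show ?thesis using 2 xy by auto
  qed (use *[of x y] *[of y x] xy in \<open>auto simp: power2_commute\<close>)
qed

section \<open>Iterated integrals and the Poincare inequality on a square\<close>

lemma continuous_on_slices:
  fixes f :: "real \<times> real \<Rightarrow> real"
  assumes "continuous_on UNIV f"
  shows "continuous_on S (\<lambda>t. f (x, t))" "continuous_on S (\<lambda>s. f (s, y))"
  by (rule continuous_on_compose2[OF assms]; auto intro!: continuous_intros)+

lemma continuous_on_integral_slices:
  fixes f :: "real \<times> real \<Rightarrow> real"
  assumes "continuous_on UNIV f"
  shows "continuous_on S (\<lambda>x. integral {c..d} (\<lambda>y. f (x, y)))"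
    "continuous_on S (\<lambda>y. integral {a..b} (\<lambda>x. f (x, y)))"
proof -
  have "continuous_on (S \<times> cbox c d) (\<lambda>(x, y). f (x, y))"
    "continuous_on (S \<times> cbox a b) (\<lambda>(y, x). f (x, y))"
    unfolding case_prod_unfold
    by (rule continuous_on_compose2[OF assms]; auto intro!: continuous_intros)+
  then show "continuous_on S (\<lambda>x. integral {c..d} (\<lambda>y. f (x, y)))"
    "continuous_on S (\<lambda>y. integral {a..b} (\<lambda>x. f (x, y)))"
    by (metis integral_continuous_on_param box_real(2))+
qed

lemma integral_cbox_Pair:
  fixes f :: "real \<times> real \<Rightarrow> real"
  assumes "continuous_on UNIV f"
  shows "integral (cbox (a, c) (b, d)) f = integral {a..b} (\<lambda>x. integral {c..d} (\<lambda>y. f (x, y)))"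
    "integral (cbox (a, c) (b, d)) f = integral {c..d} (\<lambda>y. integral {a..b} (\<lambda>x. f (x, y)))"
proof -
  have c: "continuous_on (cbox (a, c) (b, d)) f"
    using assms continuous_on_subset by blast
  show 1: "integral (cbox (a, c) (b, d)) f = integral {a..b} (\<lambda>x. integral {c..d} (\<lambda>y. f (x, y)))"
    using integral_prod_continuous[OF c] by simp
  have "continuous_on (cbox (a, c) (b, d)) (\<lambda>(x, y). f (x, y))"
    using c by simp
  from integral_swap_continuous[OF this]
  show "integral (cbox (a, c) (b, d)) f = integral {c..d} (\<lambda>y. integral {a..b} (\<lambda>x. f (x, y)))"
    unfolding 1 by simp
qed

lemma integrable_on_cbox:
  fixes f :: "real \<times> real \<Rightarrow> real"
  shows "continuous_on UNIV f \<Longrightarrow> f integrable_on cbox p q"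
  using continuous_on_subset integrable_continuous by blast

text \<open>The mean value is the best constant approximation in L2, so \<open>f\<close> may be
  compared with its value at any one point. The comparison runs along a horizontal and then a
  vertical segment; averaging over the position of the vertical one turns a line integral into an
  area integral.\<close>

lemma poincare_square:
  fixes f :: "real \<times> real \<Rightarrow> real" and a c e :: real
  assumes f: "smooth_R2 f" and e: "0 < e"
  defines "Q \<equiv> cbox (a, c) (a + e, c + e)"
  shows "integral Q (\<lambda>x. (f x)\<^sup>2) \<le> (integral Q f)\<^sup>2 / e\<^sup>2
    + 2 * e\<^sup>2 * integral Q (\<lambda>x. (pd1 f x)\<^sup>2 + (pd2 f x)\<^sup>2)"
proof -
  note cf = smooth_R2_continuous_on[OF f] and c1 = smooth_R2_continuous_on[OF smooth_R2_pd1[OF f]]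
    and c2 = smooth_R2_continuous_on[OF smooth_R2_pd2[OF f]]
  let ?G1 = "\<lambda>y. integral {a..a+e} (\<lambda>s. (pd1 f (s, y))\<^sup>2)"
  let ?G2 = "\<lambda>x. integral {c..c+e} (\<lambda>t. (pd2 f (x, t))\<^sup>2)"
  define A where "A = integral Q f"
  \<comment> \<open>The squared L2 distance on \<open>Q\<close> from \<open>f\<close> to its mean
    \<open>A / e\<^sup>2\<close>.\<close>
  define V where "V = integral Q (\<lambda>x. (f x)\<^sup>2) - A\<^sup>2 / e\<^sup>2"
  define I1 where "I1 = integral Q (\<lambda>x. (pd1 f x)\<^sup>2)"
  define I2 where "I2 = integral Q (\<lambda>x. (pd2 f x)\<^sup>2)"
  have cc: "continuous_on UNIV (\<lambda>x. (f x)\<^sup>2)" "continuous_on UNIV (\<lambda>x. (pd1 f x)\<^sup>2)"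
     "continuous_on UNIV (\<lambda>x. (pd2 f x)\<^sup>2)"
    by (intro continuous_intros cf c1 c2)+
  have V_le: "V \<le> 2 * e\<^sup>2 * I1 + 2 * e ^ 3 * ?G2 s" if s: "s \<in> {a..a+e}" for s
  proof -
    \<comment> \<open>Every point \<open>(x1, x2)\<close> is joined to \<open>(s, c)\<close> through
      \<open>(s, x2)\<close>; the horizontal leg costs \<open>e * ?G1 x2\<close>, the vertical one
      \<open>e * ?G2 s\<close>.\<close>
    define k where "k = f (s, c)"
    have meas: "Henstock_Kurzweil_Integration.content (cbox (a, c) (a + e, c + e)) = e\<^sup>2"
      using e by (simp add: content_Pair power2_eq_square)
    have cG: "continuous_on UNIV (\<lambda>x::real \<times> real. ?G1 (snd x))"
      by (rule continuous_on_compose2[OF continuous_on_integral_slices(2)[OF cc(2)], of UNIV])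
         (auto intro: continuous_intros)
    have "V \<le> integral Q (\<lambda>x. (f x)\<^sup>2) - 2 * k * A + k\<^sup>2 * e\<^sup>2"
    proof -
      \<comment> \<open>Completing the square in \<open>k\<close>: equality would hold for
        \<open>k\<close> equal to the mean.\<close>
      have "0 \<le> (A / e - k * e)\<^sup>2" by simp
      also have "\<dots> = A\<^sup>2 / e\<^sup>2 - 2 * k * A + k\<^sup>2 * e\<^sup>2"
        using e by (simp add: power2_eq_square field_simps)
      finally show ?thesis unfolding V_def by simp
    qed
    also have "\<dots> = integral Q (\<lambda>x. (f x)\<^sup>2 - 2 * k * f x + k\<^sup>2)"
      unfolding Q_def
      by (subst integral_add integral_diff; (intro integrable_on_cbox continuous_intros cf)?)+
         (simp add: A_def Q_def meas)
    also have "\<dots> \<le> integral Q (\<lambda>x. 2 * e * ?G1 (snd x) + 2 * e * ?G2 s)"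
      unfolding Q_def
    proof (intro integral_le integrable_on_cbox continuous_intros cf cG)
      fix x assume "x \<in> cbox (a, c) (a + e, c + e)"
      then obtain x1 x2 where x: "x = (x1, x2)" "x1 \<in> {a..a+e}" "x2 \<in> {c..c+e}"
        by (cases x) auto
      have "(f (x1, x2) - f (s, x2))\<^sup>2 \<le> (a + e - a) * ?G1 x2"
        by (rule square_diff_le_integral_deriv[OF pd_has_real_derivative(1)[OF f]
              continuous_on_slices(2)[OF c1] x(2) s])
      moreover have "(f (s, x2) - f (s, c))\<^sup>2 \<le> (c + e - c) * ?G2 s"
        using e by (intro square_diff_le_integral_deriv[OF pd_has_real_derivative(2)[OF f]
              continuous_on_slices(1)[OF c2] x(3)]) auto
      moreover have "(f (x1, x2) - k)\<^sup>2
          \<le> 2 * (f (x1, x2) - f (s, x2))\<^sup>2 + 2 * (f (s, x2) - f (s, c))\<^sup>2"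
        using zero_le_power2[of "(f (x1, x2) - f (s, x2)) - (f (s, x2) - k)"]
        unfolding k_def by (simp add: power2_eq_square algebra_simps)
      ultimately show "(f x)\<^sup>2 - 2 * k * f x + k\<^sup>2 \<le> 2 * e * ?G1 (snd x) + 2 * e * ?G2 s"
        by (simp add: x power2_diff algebra_simps)
    qed
    also have "\<dots> = 2 * e * integral Q (\<lambda>x. ?G1 (snd x)) + 2 * e * (e\<^sup>2 * ?G2 s)"
      unfolding Q_def
      by (subst integral_add; (intro integrable_on_cbox continuous_intros cG)?) (simp add: meas)
    also have "integral Q (\<lambda>x. ?G1 (snd x)) = e * I1"
      unfolding Q_def I1_def integral_cbox_Pair(2)[OF cc(2)] integral_cbox_Pair(1)[OF cG]
      using e by simp
    finally show ?thesis
      by (simp add: power2_eq_square power3_eq_cube mult_ac)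
  qed
  \<comment> \<open>Only \<open>?G2 s\<close> depends on \<open>s\<close>, and its integral over
    \<open>s\<close> is \<open>I2\<close>; dividing by \<open>e\<close> then gives both terms the
    same factor \<open>2 * e\<^sup>2\<close>.\<close>
  have "integral {a..a+e} (\<lambda>s. V) \<le> integral {a..a+e} (\<lambda>s. 2 * e\<^sup>2 * I1 + 2 * e ^ 3 * ?G2 s)"
    using V_le
    by (intro integral_le integrable_continuous_real continuous_intros
        continuous_on_integral_slices(1)[OF cc(3)]) auto
  also have "\<dots> = e * (2 * e\<^sup>2 * I1) + 2 * e ^ 3 * I2"
    unfolding I2_def Q_def integral_cbox_Pair(1)[OF cc(3)] using e
    by (subst integral_add; (intro integrable_continuous_real continuous_intros
        continuous_on_integral_slices(1)[OF cc(3)])?) auto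
  also have "\<dots> = e * (2 * e\<^sup>2 * (I1 + I2))"
    by (simp add: power2_eq_square power3_eq_cube algebra_simps)
  finally have "V \<le> 2 * e\<^sup>2 * (I1 + I2)"
    using e by simp
  also have "I1 + I2 = integral Q (\<lambda>x. (pd1 f x)\<^sup>2 + (pd2 f x)\<^sup>2)"
    unfolding I1_def I2_def Q_def
    by (rule integral_add[symmetric]; intro integrable_on_cbox cc)
  finally show ?thesis
    unfolding V_def A_def by simp
qed

section \<open>Uniform grids on the unit square\<close>

lemma integral_real_grid:
  fixes g :: "real \<Rightarrow> real"
  assumes "continuous_on UNIV g" "0 \<le> e" "m \<le> n"
  shows "integral {real m * e..real n * e} g
    = (\<Sum>i\<in>{m..<n}. integral {real i * e..real i * e + e} g)"
  using assms(3)
proof (induction n rule: dec_induct)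
  case (step n)
  have "integral {real m * e..real (Suc n) * e} g
    = integral {real m * e..real n * e} g + integral {real n * e..real (Suc n) * e} g"
    using assms step
    by (intro Henstock_Kurzweil_Integration.integral_combine[symmetric] integrable_continuous_real)
       (auto intro: continuous_on_subset mult_right_mono)
  then show ?case
    using step by (simp add: algebra_simps)
qed simp

lemma integral_cbox_grid:
  fixes f :: "real \<times> real \<Rightarrow> real"
  assumes f: "continuous_on UNIV f" and e: "0 \<le> e" and m: "m \<le> n"
  shows "integral (cbox (real m * e, 0) (real n * e, real k * e)) f
    = (\<Sum>i\<in>{m..<n}. \<Sum>j<k. integral (cbox (real i * e, real j * e) (real i * e + e, real j * e + e)) f)"
proof -
  have "integral (cbox (real m * e, 0) (real n * e, real k * e)) f
    = (\<Sum>i\<in>{m..<n}. integral {real i * e..real i * e + e}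
         (\<lambda>x. integral {real 0 * e..real k * e} (\<lambda>y. f (x, y))))"
    unfolding integral_cbox_Pair(1)[OF f]
    using integral_real_grid[OF continuous_on_integral_slices(1)[OF f] e m, of 0 "real k * e"] by simp
  also have "\<dots> = (\<Sum>i\<in>{m..<n}. integral {real i * e..real i * e + e}
         (\<lambda>x. \<Sum>j<k. integral {real j * e..real j * e + e} (\<lambda>y. f (x, y))))"
    using integral_real_grid[OF continuous_on_slices(1)[OF f] e, of 0 k]
    by (simp add: lessThan_atLeast0)
  also have "\<dots> = (\<Sum>i\<in>{m..<n}. \<Sum>j<k. integral (cbox (real i * e, real j * e) (real i * e + e, real j * e + e)) f)"
    unfolding integral_cbox_Pair(1)[OF f]
    by (intro sum.cong integral_sum integrable_continuous_real continuous_on_integral_slices(1)[OF f]) auto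
  finally show ?thesis .
qed

text \<open>Each value is an increment from the edge x1 = 0, where \<open>f\<close> vanishes. One
  factor \<open>\<delta>\<close> comes from Cauchy-Schwarz along the horizontal segment, the other
  from integrating over the width of the strip.\<close>

lemma strip_estimate:
  fixes f :: "real \<times> real \<Rightarrow> real"
  assumes f: "smooth_R2 f" and z: "\<And>y. f (0, y) = 0" and \<delta>: "0 \<le> \<delta>" "\<delta> \<le> 1"
  shows "integral (cbox (0, 0) (\<delta>, 1)) (\<lambda>x. (f x)\<^sup>2)
     \<le> \<delta>\<^sup>2 * integral (cbox (0, 0) (1, 1)) (\<lambda>x. (pd1 f x)\<^sup>2)"
proof -
  note cf = smooth_R2_continuous_on[OF f] and c1 = smooth_R2_continuous_on[OF smooth_R2_pd1[OF f]]
  have cc: "continuous_on UNIV (\<lambda>x. (f x)\<^sup>2)" "continuous_on UNIV (\<lambda>x. (pd1 f x)\<^sup>2)"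
    by (intro continuous_intros cf c1)+
  let ?G = "\<lambda>y. integral {0..\<delta>} (\<lambda>s. (pd1 f (s, y))\<^sup>2)"
  have *: "(f (x, y))\<^sup>2 \<le> \<delta> * ?G y" if "x \<in> {0..\<delta>}" for x y
    using square_diff_le_integral_deriv[OF pd_has_real_derivative(1)[OF f]
        continuous_on_slices(2)[OF c1] that, of 0 y] that z by auto
  have "integral (cbox (0, 0) (\<delta>, 1)) (\<lambda>x. (f x)\<^sup>2)
     = integral {0..1} (\<lambda>y. integral {0..\<delta>} (\<lambda>x. (f (x, y))\<^sup>2))"
    by (rule integral_cbox_Pair(2)[OF cc(1)])
  also have "\<dots> \<le> integral {0..1} (\<lambda>y. \<delta>\<^sup>2 * ?G y)"
  proof (intro integral_le integrable_continuous_real continuous_intros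
      continuous_on_integral_slices(2) cf c1)
    fix y
    have "integral {0..\<delta>} (\<lambda>x. (f (x, y))\<^sup>2) \<le> integral {0..\<delta>} (\<lambda>x. \<delta> * ?G y)"
      by (intro integral_le integrable_continuous_real continuous_on_slices(2)[OF cc(1)] *) auto
    then show "integral {0..\<delta>} (\<lambda>x. (f (x, y))\<^sup>2) \<le> \<delta>\<^sup>2 * ?G y"
      using \<delta> by (simp add: power2_eq_square mult_ac)
  qed
  also have "\<dots> = \<delta>\<^sup>2 * integral (cbox (0, 0) (\<delta>, 1)) (\<lambda>x. (pd1 f x)\<^sup>2)"
    unfolding integral_cbox_Pair(2)[OF cc(2)] by simp
  also have "\<dots> \<le> \<delta>\<^sup>2 * integral (cbox (0, 0) (1, 1)) (\<lambda>x. (pd1 f x)\<^sup>2)"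
    using \<delta> by (intro mult_left_mono integral_subset_le integrable_on_cbox cc) auto
  finally show ?thesis .
qed

text \<open>Written as corner plus side length to match the squares of
  \<open>poincare_square\<close>.\<close>

definition cell :: "nat \<Rightarrow> nat \<Rightarrow> nat \<Rightarrow> (real \<times> real) set" where
  "cell N i j = cbox (real i / real N, real j / real N) (real i / real N + 1 / real N, real j / real N + 1 / real N)"

text \<open>The column of index \<open>m\<close> starts exactly at x1 = \<open>1 / real K\<close>,
  so the columns from \<open>m\<close> on tile the complement of the strip. The x2-derivative
  therefore enters only where the weight will be bounded below.\<close>

lemma L2_le_cells:
  fixes f :: "real \<times> real \<Rightarrow> real"
  assumes f: "smooth_R2 f" and z: "\<And>y. f (0, y) = 0" and K: "0 < K" and m: "0 < m"
  defines "N \<equiv> K * m"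
  shows "integral (cbox (0, 0) (1, 1)) (\<lambda>x. (f x)\<^sup>2)
    \<le> (1 / real K)\<^sup>2 * integral (cbox (0, 0) (1, 1)) (\<lambda>x. (pd1 f x)\<^sup>2)
      + (real N)\<^sup>2 * (\<Sum>i<N. \<Sum>j<N. (integral (cell N i j) f)\<^sup>2)
      + 2 / (real N)\<^sup>2 * integral (cbox (1 / real K, 0) (1, 1)) (\<lambda>x. (pd1 f x)\<^sup>2 + (pd2 f x)\<^sup>2)"
proof -
  note cf = smooth_R2_continuous_on[OF f] and c1 = smooth_R2_continuous_on[OF smooth_R2_pd1[OF f]]
    and c2 = smooth_R2_continuous_on[OF smooth_R2_pd2[OF f]]
  define e where "e = 1 / real N"
  have N: "0 < N" "m \<le> N" using K m by (auto simp: N_def)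
  have e: "0 < e" "real m * e = 1 / real K" "real N * e = 1" "1 / real N = e"
    using N K m by (auto simp: e_def N_def)
  have cell: "cell N i j = cbox (real i * e, real j * e) (real i * e + e, real j * e + e)" for i j
    by (simp add: cell_def e_def)
  have cc: "continuous_on UNIV (\<lambda>x. (f x)\<^sup>2)" "continuous_on UNIV (\<lambda>x. (pd1 f x)\<^sup>2 + (pd2 f x)\<^sup>2)"
    by (intro continuous_intros cf c1 c2)+
  have grid: "integral (cbox (1 / real K, 0) (1, 1)) g = (\<Sum>i\<in>{m..<N}. \<Sum>j<N. integral (cell N i j) g)"
    if "continuous_on UNIV g" for g :: "real \<times> real \<Rightarrow> real"
    using integral_cbox_grid[OF that, of e m N N] e N by (simp add: cell)
  have K1: "1 / real K \<le> 1" using K by simp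
  have "integral (cbox (0, 0) (1, 1)) (\<lambda>x. (f x)\<^sup>2)
     = integral (cbox (0, 0) (1 / real K, 1)) (\<lambda>x. (f x)\<^sup>2)
       + integral (cbox (1 / real K, 0) (1, 1)) (\<lambda>x. (f x)\<^sup>2)"
    unfolding integral_cbox_Pair(1)[OF cc(1)]
    using K1 by (intro Henstock_Kurzweil_Integration.integral_combine[symmetric] integrable_continuous_real continuous_on_integral_slices(1) cc) auto
  also have "integral (cbox (1 / real K, 0) (1, 1)) (\<lambda>x. (f x)\<^sup>2)
     \<le> (\<Sum>i\<in>{m..<N}. \<Sum>j<N. (integral (cell N i j) f)\<^sup>2 / e\<^sup>2
    + 2 * e\<^sup>2 * integral (cell N i j) (\<lambda>x. (pd1 f x)\<^sup>2 + (pd2 f x)\<^sup>2))"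
    unfolding grid[OF cc(1)] cell by (intro sum_mono poincare_square[OF f e(1)])
  also have "\<dots> = (\<Sum>i\<in>{m..<N}. \<Sum>j<N. (integral (cell N i j) f)\<^sup>2) / e\<^sup>2
     + 2 * e\<^sup>2 * integral (cbox (1 / real K, 0) (1, 1)) (\<lambda>x. (pd1 f x)\<^sup>2 + (pd2 f x)\<^sup>2)"
    unfolding grid[OF cc(2)] by (simp add: sum.distrib sum_distrib_left sum_divide_distrib)
  \<comment> \<open>The columns inside the strip add nonnegative terms; including them makes the
    index set a full square.\<close>
  also have "(\<Sum>i\<in>{m..<N}. \<Sum>j<N. (integral (cell N i j) f)\<^sup>2) / e\<^sup>2
     \<le> (\<Sum>i<N. \<Sum>j<N. (integral (cell N i j) f)\<^sup>2) / e\<^sup>2"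
    by (intro divide_right_mono sum_mono2) (auto intro: sum_nonneg)
  also have "integral (cbox (0, 0) (1 / real K, 1)) (\<lambda>x. (f x)\<^sup>2)
     \<le> (1 / real K)\<^sup>2 * integral (cbox (0, 0) (1, 1)) (\<lambda>x. (pd1 f x)\<^sup>2)"
    using K1 by (intro strip_estimate f z) auto
  finally show ?thesis
    by (simp add: e_def power_divide mult.commute)
qed

section \<open>Square-integrable functions\<close>

lemma integrable_square_diff:
  fixes f g :: "'a \<Rightarrow> real"
  assumes [measurable]: "f \<in> borel_measurable M" "g \<in> borel_measurable M"
    and "integrable M (\<lambda>x. (f x)\<^sup>2)" "integrable M (\<lambda>x. (g x)\<^sup>2)"
  shows "integrable M (\<lambda>x. (f x - g x)\<^sup>2)"
proof (rule Bochner_Integration.integrable_bound)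
  show "integrable M (\<lambda>x. 2 * (f x)\<^sup>2 + 2 * (g x)\<^sup>2)"
    using assms by simp
  have "(f x - g x)\<^sup>2 \<le> 2 * (f x)\<^sup>2 + 2 * (g x)\<^sup>2" for x
    using zero_le_power2[of "f x + g x"] by (simp add: power2_eq_square algebra_simps)
  then show "AE x in M. norm ((f x - g x)\<^sup>2) \<le> norm (2 * (f x)\<^sup>2 + 2 * (g x)\<^sup>2)"
    by simp
qed simp

lemma integrable_mult_square:
  fixes f g :: "'a \<Rightarrow> real"
  assumes [measurable]: "f \<in> borel_measurable M" "g \<in> borel_measurable M"
    and "integrable M (\<lambda>x. (f x)\<^sup>2)" "integrable M (\<lambda>x. (g x)\<^sup>2)"
  shows "integrable M (\<lambda>x. f x * g x)"
proof (rule Bochner_Integration.integrable_bound)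
  show "integrable M (\<lambda>x. (f x)\<^sup>2 + (g x)\<^sup>2)"
    using assms by simp
  have "\<bar>f x * g x\<bar> \<le> (f x)\<^sup>2 + (g x)\<^sup>2" for x
    using zero_le_power2[of "\<bar>f x\<bar> - \<bar>g x\<bar>"] zero_le_power2[of "f x"] zero_le_power2[of "g x"]
    unfolding power2_diff power2_abs abs_mult by linarith
  then show "AE x in M. norm (f x * g x) \<le> norm ((f x)\<^sup>2 + (g x)\<^sup>2)"
    by simp
qed simp

text \<open>On a finite measure space, fast L2 decay of the increments makes the sum of their L1
  norms finite, so the telescoping series converges absolutely almost everywhere.\<close>

lemma AE_convergent_subseq_of_fast_L2_Cauchy:
  fixes f :: "nat \<Rightarrow> 'a \<Rightarrow> real"
  assumes fin: "finite_measure M"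
    and meas [measurable]: "\<And>n. f n \<in> borel_measurable M"
    and sq: "\<And>n. integrable M (\<lambda>x. (f n x)\<^sup>2)"
    and fast: "\<And>n. (\<integral>x. (f (Suc n) x - f n x)\<^sup>2 \<partial>M) \<le> (1 / 4) ^ n"
  shows "AE x in M. convergent (\<lambda>n. f n x)"
proof -
  interpret finite_measure M by fact
  define g where "g n x = \<bar>f (Suc n) x - f n x\<bar>" for n x
  define B where "B = 1 + measure M (space M)"
  have [measurable]: "g n \<in> borel_measurable M" for n
    unfolding g_def by measurable
  have isq: "integrable M (\<lambda>x. (f (Suc n) x - f n x)\<^sup>2)" for n
    by (intro integrable_square_diff meas sq)
  have "(\<integral>\<^sup>+x. ennreal (g n x) \<partial>M) \<le> ennreal (B * (1 / 2) ^ n)" for n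
  proof -
    \<comment> \<open>From \<open>t \<le> t\<^sup>2 + 1\<close> at \<open>t = 2 ^ n * g n x\<close>.
      The scale \<open>2 ^ n\<close> balances the bound \<open>(1 / 4) ^ n\<close>, so that both
      terms integrate to order \<open>(1 / 2) ^ n\<close>.\<close>
    let ?G = "\<lambda>x. 2 ^ n * (f (Suc n) x - f n x)\<^sup>2 + (1 / 2) ^ n"
    have "g n x \<le> ?G x" for x
    proof -
      have "t \<le> t\<^sup>2 + 1" if "0 \<le> t" for t :: real
        using zero_le_power2[of "t - 1"] that by (simp add: power2_diff)
      then have "2 ^ n * (g n x) \<le> (2 ^ n * g n x)\<^sup>2 + 1"
        by (simp add: g_def)
      then have "(1 / 2) ^ n * (2 ^ n * (g n x)) \<le> (1 / 2) ^ n * ((2 ^ n * g n x)\<^sup>2 + 1)"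
        by (intro mult_left_mono) auto
      then show ?thesis
        by (simp add: g_def power_mult_distrib power2_eq_square field_simps)
    qed
    then have "(\<integral>\<^sup>+x. ennreal (g n x) \<partial>M) \<le> (\<integral>\<^sup>+x. ennreal (?G x) \<partial>M)"
      by (intro nn_integral_mono ennreal_leI)
    also have "\<dots> = ennreal (\<integral>x. ?G x \<partial>M)"
      using isq by (intro nn_integral_eq_integral Bochner_Integration.integrable_add) auto
    also have "(\<integral>x. ?G x \<partial>M) = 2 ^ n * (\<integral>x. (f (Suc n) x - f n x)\<^sup>2 \<partial>M) + (1 / 2) ^ n * measure M (space M)"
      using isq by (subst Bochner_Integration.integral_add) auto
    also have "\<dots> \<le> 2 ^ n * (1 / 4) ^ n + (1 / 2) ^ n * measure M (space M)"
      by (intro add_right_mono mult_left_mono fast) auto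
    also have "2 ^ n * (1 / 4) ^ n = ((1 / 2) ^ n :: real)"
      unfolding power_mult_distrib[symmetric] by simp
    finally show ?thesis
      by (simp add: B_def algebra_simps ennreal_leI)
  qed
  then have "(\<Sum>n. \<integral>\<^sup>+x. ennreal (g n x) \<partial>M) \<le> (\<Sum>n. ennreal (B * (1 / 2) ^ n))"
    by (intro suminf_le) auto
  also have "\<dots> = ennreal (\<Sum>n. B * (1 / 2) ^ n)"
    by (intro suminf_ennreal2 summable_mult summable_geometric) (auto simp: B_def)
  also have "\<dots> < \<infinity>" by simp
  finally have "(\<integral>\<^sup>+x. (\<Sum>n. ennreal (g n x)) \<partial>M) \<noteq> \<infinity>"
    by (subst nn_integral_suminf) auto
  then have "AE x in M. (\<Sum>n. ennreal (g n x)) \<noteq> \<infinity>"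
    by (intro nn_integral_noteq_infinite) auto
  then show ?thesis
  proof eventually_elim
    case (elim x)
    have "summable (\<lambda>n. g n x)"
      using elim by (intro summable_suminf_not_top) (auto simp: g_def)
    then have "summable (\<lambda>n. f (Suc n) x - f n x)"
      unfolding g_def by (rule summable_rabs_cancel)
    then have "convergent (\<lambda>n. \<Sum>i<n. f (Suc i) x - f i x)"
      by (simp add: summable_iff_convergent)
    then have "convergent (\<lambda>n. f n x - f 0 x)"
      by (simp add: sum_lessThan_telescope[of "\<lambda>n. f n x"])
    then have "convergent (\<lambda>n. (f n x - f 0 x) + f 0 x)"
      by (intro convergent_add convergent_const)
    then show ?case by simp
  qed
qed

text \<open>Riesz-Fischer: a rapidly Cauchy subsequence converges almost everywhere, and Fatou's
  lemma shows that its pointwise limit is the L2 limit of the whole sequence.\<close>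

lemma L2_Cauchy_imp_convergent:
  fixes f :: "nat \<Rightarrow> 'a \<Rightarrow> real"
  assumes fin: "finite_measure M"
    and meas [measurable]: "\<And>n. f n \<in> borel_measurable M"
    and sq: "\<And>n. integrable M (\<lambda>x. (f n x)\<^sup>2)"
    and Cauchy: "\<And>e. e > 0 \<Longrightarrow> \<exists>N. \<forall>m\<ge>N. \<forall>n\<ge>N. (\<integral>x. (f m x - f n x)\<^sup>2 \<partial>M) \<le> e"
  obtains v where "v \<in> borel_measurable M" "integrable M (\<lambda>x. (v x)\<^sup>2)"
    "(\<lambda>n. \<integral>x. (f n x - v x)\<^sup>2 \<partial>M) \<longlonglongrightarrow> 0"
proof -
  obtain N where N: "\<And>k m n. m \<ge> N k \<Longrightarrow> n \<ge> N k \<Longrightarrow> (\<integral>x. (f m x - f n x)\<^sup>2 \<partial>M) \<le> (1 / 4) ^ k"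
    using Cauchy[of "(1 / 4) ^ k" for k] by simp metis
  \<comment> \<open>Partial sums dominate every \<open>N i\<close> with \<open>i \<le> n\<close>
    without monotonicity of \<open>N\<close>, and the \<open>Suc\<close> forces
    \<open>n \<le> r n\<close>.\<close>
  define r where "r n = (\<Sum>i\<le>n. Suc (N i))" for n
  have rN: "N n \<le> r n" "N n \<le> r (Suc n)" for n
  proof -
    have "Suc (N n) \<le> r n"
      unfolding r_def by (rule member_le_sum) auto
    then show "N n \<le> r n" "N n \<le> r (Suc n)"
      by (auto simp: r_def)
  qed
  have rn: "n \<le> r n" for n
    by (induction n) (auto simp: r_def)
  define v where "v x = lim (\<lambda>n. f (r n) x)" for x
  have [measurable]: "v \<in> borel_measurable M"
    unfolding v_def by measurable
  have "AE x in M. convergent (\<lambda>n. f (r n) x)"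
    using rN N by (intro AE_convergent_subseq_of_fast_L2_Cauchy fin meas sq) auto
  then have lim: "AE x in M. (\<lambda>n. f (r n) x) \<longlonglongrightarrow> v x"
    by eventually_elim (simp add: v_def convergent_LIMSEQ_iff)
  \<comment> \<open>Stated with the nonnegative integral because integrability of
    \<open>(f n x - v x)\<^sup>2\<close> is only deduced from it.\<close>
  have key: "(\<integral>\<^sup>+x. ennreal ((f n x - v x)\<^sup>2) \<partial>M) \<le> ennreal e"
    if e: "e > 0" and le: "\<forall>m\<ge>N'. \<forall>n\<ge>N'. (\<integral>x. (f m x - f n x)\<^sup>2 \<partial>M) \<le> e" and n: "n \<ge> N'" for e N' n
  proof -
    have "(\<integral>\<^sup>+x. ennreal ((f n x - v x)\<^sup>2) \<partial>M)
       = (\<integral>\<^sup>+x. liminf (\<lambda>k. ennreal ((f n x - f (r k) x)\<^sup>2)) \<partial>M)"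
    proof (rule nn_integral_cong_AE, use lim in eventually_elim)
      case (elim x)
      have "(\<lambda>k. ennreal ((f n x - f (r k) x)\<^sup>2)) \<longlonglongrightarrow> ennreal ((f n x - v x)\<^sup>2)"
        by (intro tendsto_intros elim)
      then show ?case
        by (rule lim_imp_Liminf[OF sequentially_bot, symmetric])
    qed
    also have "\<dots> \<le> liminf (\<lambda>k. \<integral>\<^sup>+x. ennreal ((f n x - f (r k) x)\<^sup>2) \<partial>M)"
      by (rule nn_integral_liminf) simp
    also have "\<dots> \<le> ennreal e"
    proof (rule Liminf_le)
      show "\<forall>\<^sub>F k in sequentially. (\<integral>\<^sup>+x. ennreal ((f n x - f (r k) x)\<^sup>2) \<partial>M) \<le> ennreal e"
        using eventually_ge_at_top[of N']
      proof eventually_elim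
        case (elim k)
        then have "r k \<ge> N'" using rn[of k] by simp
        then have "(\<integral>x. (f n x - f (r k) x)\<^sup>2 \<partial>M) \<le> e"
          using le n by blast
        then show ?case
          by (subst nn_integral_eq_integral) (auto intro: integrable_square_diff sq ennreal_leI)
      qed
    qed simp
    finally show ?thesis .
  qed
  obtain N1 where N1: "\<forall>m\<ge>N1. \<forall>n\<ge>N1. (\<integral>x. (f m x - f n x)\<^sup>2 \<partial>M) \<le> 1"
    using Cauchy[of 1] by auto
  have "integrable M (\<lambda>x. (f N1 x - v x)\<^sup>2)"
    using key[OF _ N1, of N1] by (intro integrableI_nonneg) (auto simp: le_less_trans)
  \<comment> \<open>Uses \<open>v = f N1 - (f N1 - v)\<close>.\<close>
  then have vsq: "integrable M (\<lambda>x. (v x)\<^sup>2)"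
    using integrable_square_diff[OF meas _ sq, of "\<lambda>x. f N1 x - v x" N1] by simp
  have "(\<lambda>n. \<integral>x. (f n x - v x)\<^sup>2 \<partial>M) \<longlonglongrightarrow> 0"
  proof (rule LIMSEQ_I)
    fix e :: real assume "0 < e"
    then obtain N' where N': "\<forall>m\<ge>N'. \<forall>n\<ge>N'. (\<integral>x. (f m x - f n x)\<^sup>2 \<partial>M) \<le> e / 2"
      using Cauchy[of "e / 2"] by auto
    have "(\<integral>x. (f n x - v x)\<^sup>2 \<partial>M) \<le> e / 2" if "n \<ge> N'" for n
    proof -
      have "ennreal (\<integral>x. (f n x - v x)\<^sup>2 \<partial>M) \<le> ennreal (e / 2)"
        using key[OF _ N' that] \<open>0 < e\<close>
        by (subst nn_integral_eq_integral[symmetric]) (auto intro: integrable_square_diff sq vsq)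
      then show ?thesis using \<open>0 < e\<close> by (simp add: ennreal_le_iff)
    qed
    then show "\<exists>no. \<forall>n\<ge>no. norm ((\<integral>x. (f n x - v x)\<^sup>2 \<partial>M) - 0) < e"
      using \<open>0 < e\<close> by (intro exI[of _ N']) (fastforce simp: abs_of_nonneg)
  qed
  with vsq show ?thesis by (intro that) auto
qed

section \<open>Integrals of functions vanishing off a smaller set\<close>

lemma lebesgue_on_support:
  fixes f :: "'a::euclidean_space \<Rightarrow> real"
  assumes "K \<in> sets lebesgue" "U \<in> sets lebesgue" "K \<subseteq> U" "\<And>x. x \<in> U - K \<Longrightarrow> f x = 0"
  shows "integrable (lebesgue_on U) f \<longleftrightarrow> integrable (lebesgue_on K) f"
    "(\<integral>x. f x \<partial>lebesgue_on U) = (\<integral>x. f x \<partial>lebesgue_on K)"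
proof -
  have "(\<lambda>x. indicator U x *\<^sub>R f x) = (\<lambda>x. indicator K x *\<^sub>R f x)"
    using assms(3,4) by (auto simp: indicator_def fun_eq_iff)
  then show "integrable (lebesgue_on U) f \<longleftrightarrow> integrable (lebesgue_on K) f"
    "(\<integral>x. f x \<partial>lebesgue_on U) = (\<integral>x. f x \<partial>lebesgue_on K)"
    using assms(1,2) by (simp_all add: integrable_restrict_space integral_restrict_space)
qed

lemma Omega_sets: "Omega \<in> sets lebesgue"
proof -
  have "open Omega"
    unfolding Omega_def by (intro open_Times) auto
  then show ?thesis by simp
qed

lemma Omega_subset: "Omega \<subseteq> cbox (0, 0) (1, 1)"
  by (auto simp: Omega_def)

lemma finite_measure_Omega: "finite_measure (lebesgue_on Omega)"
proof -
  have "Omega \<in> lmeasurable"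
    using Omega_sets Omega_subset by (meson bounded_cbox bounded_set_imp_lmeasurable bounded_subset)
  then show ?thesis
    by (simp add: finite_measure_lebesgue_on)
qed

lemma lebesgue_on_Omega_eq_integral:
  fixes f :: "real \<times> real \<Rightarrow> real"
  assumes "continuous_on UNIV f" "\<And>x. x \<notin> Omega \<Longrightarrow> f x = 0"
  shows "integrable (lebesgue_on Omega) f"
    "(\<integral>x. f x \<partial>lebesgue_on Omega) = integral (cbox (0, 0) (1, 1)) f"
proof -
  let ?Q = "cbox (0, 0) (1, 1) :: (real \<times> real) set"
  have Q: "integrable (lebesgue_on ?Q) f"
    using assms(1) by (intro continuous_imp_integrable) (rule continuous_on_subset, auto)
  have eq: "integrable (lebesgue_on ?Q) f \<longleftrightarrow> integrable (lebesgue_on Omega) f"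
    "(\<integral>x. f x \<partial>lebesgue_on ?Q) = (\<integral>x. f x \<partial>lebesgue_on Omega)"
    by (rule lebesgue_on_support; use Omega_sets Omega_subset assms(2) in auto)+
  show "integrable (lebesgue_on Omega) f" using eq(1) Q by simp
  show "(\<integral>x. f x \<partial>lebesgue_on Omega) = integral ?Q f"
    unfolding eq(2)[symmetric] using Q by (intro lebesgue_integral_eq_integral) auto
qed

lemma test_fun_square:
  assumes "test_fun Omega f"
  shows "f \<in> borel_measurable (lebesgue_on Omega)" "integrable (lebesgue_on Omega) (\<lambda>x. (f x)\<^sup>2)"
    "(\<integral>x. (f x)\<^sup>2 \<partial>lebesgue_on Omega) = integral (cbox (0, 0) (1, 1)) (\<lambda>x. (f x)\<^sup>2)"
proof -
  have c: "continuous_on S f" for S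
    by (intro smooth_R2_continuous_on test_fun_smooth[OF assms])
  show "f \<in> borel_measurable (lebesgue_on Omega)"
    by (rule continuous_imp_measurable_on_sets_lebesgue[OF c Omega_sets])
  have "continuous_on UNIV (\<lambda>x. (f x)\<^sup>2)" "\<And>x. x \<notin> Omega \<Longrightarrow> (f x)\<^sup>2 = 0"
    using test_fun_eq_0[OF assms] by (auto intro: continuous_intros c)
  from lebesgue_on_Omega_eq_integral[OF this]
  show "integrable (lebesgue_on Omega) (\<lambda>x. (f x)\<^sup>2)"
    "(\<integral>x. (f x)\<^sup>2 \<partial>lebesgue_on Omega) = integral (cbox (0, 0) (1, 1)) (\<lambda>x. (f x)\<^sup>2)"
    by auto
qed

text \<open>Weak derivatives are only locally integrable, so pairings make sense against bounded
  factors of compact support. The bound is linear in \<open>B\<close>, so a uniformly small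
  \<open>w\<close> gives a small pairing.\<close>

lemma integrable_mult_compact_support:
  fixes g w :: "real \<times> real \<Rightarrow> real"
  assumes "loc_int Omega g" "compact K" "K \<subseteq> Omega" "w \<in> borel_measurable (lebesgue_on Omega)"
    and "\<And>x. x \<in> Omega - K \<Longrightarrow> w x = 0" and B: "\<And>x. x \<in> K \<Longrightarrow> \<bar>w x\<bar> \<le> B"
  shows "integrable (lebesgue_on Omega) (\<lambda>x. g x * w x)"
    "\<bar>\<integral>x. g x * w x \<partial>lebesgue_on Omega\<bar> \<le> B * (\<integral>x. \<bar>g x\<bar> \<partial>lebesgue_on K)"
proof -
  have K: "K \<in> sets lebesgue"
    using assms(2) by (simp add: borel_compact)
  have g: "integrable (lebesgue_on K) g"
    using assms unfolding loc_int_def by blast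
  have w [measurable]: "w \<in> borel_measurable (lebesgue_on K)"
    using assms(3,4) by (rule measurable_restrict_mono[rotated])
  have B': "\<bar>g x * w x\<bar> \<le> B * \<bar>g x\<bar>" if "x \<in> K" for x
    using mult_left_mono[OF B[OF that], of "\<bar>g x\<bar>"] by (simp add: abs_mult mult.commute)
  have int: "integrable (lebesgue_on K) (\<lambda>x. g x * w x)"
  proof (rule Bochner_Integration.integrable_bound)
    show "integrable (lebesgue_on K) (\<lambda>x. B * \<bar>g x\<bar>)"
      using g by simp
    show "(\<lambda>x. g x * w x) \<in> borel_measurable (lebesgue_on K)"
      using borel_measurable_integrable[OF g] by simp
    show "AE x in lebesgue_on K. norm (g x * w x) \<le> norm (B * \<bar>g x\<bar>)"
      using B' by (auto intro!: AE_I2 order_trans[OF _ abs_ge_self])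
  qed
  have eq: "integrable (lebesgue_on Omega) (\<lambda>x. g x * w x) \<longleftrightarrow> integrable (lebesgue_on K) (\<lambda>x. g x * w x)"
    "(\<integral>x. g x * w x \<partial>lebesgue_on Omega) = (\<integral>x. g x * w x \<partial>lebesgue_on K)"
    by (rule lebesgue_on_support; use K Omega_sets assms(3,5) in auto)+
  show "integrable (lebesgue_on Omega) (\<lambda>x. g x * w x)" using eq int by simp
  have "\<bar>\<integral>x. g x * w x \<partial>lebesgue_on K\<bar> \<le> (\<integral>x. \<bar>g x * w x\<bar> \<partial>lebesgue_on K)"
    by (rule integral_abs_bound)
  also have "\<dots> \<le> (\<integral>x. B * \<bar>g x\<bar> \<partial>lebesgue_on K)"
    using B' int g by (intro integral_mono) auto
  finally show "\<bar>\<integral>x. g x * w x \<partial>lebesgue_on Omega\<bar> \<le> B * (\<integral>x. \<bar>g x\<bar> \<partial>lebesgue_on K)"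
    unfolding eq by simp
qed

section \<open>Weighted energy bounds\<close>

text \<open>The pointwise inequality behind it is an identity with the squares of
  \<open>a + b - p\<close> and \<open>a - b\<close> dropped; the cross term integrates to zero by
  \<open>orth\<close>. For \<open>p = a + b\<close> this is the usual bound for a sum, for which it
  also serves below.\<close>

lemma L2_bound_of_orthogonal:
  fixes a b p :: "'a \<Rightarrow> real"
  assumes [measurable]: "a \<in> borel_measurable M" "b \<in> borel_measurable M" "p \<in> borel_measurable M"
    and sq: "integrable M (\<lambda>x. (a x)\<^sup>2)" "integrable M (\<lambda>x. (b x)\<^sup>2)" "integrable M (\<lambda>x. (p x)\<^sup>2)"
    and orth: "(\<integral>x. (a x + b x - p x) * p x \<partial>M) = 0"
  shows "(\<integral>x. (p x)\<^sup>2 \<partial>M) \<le> 2 * (\<integral>x. (a x)\<^sup>2 \<partial>M) + 2 * (\<integral>x. (b x)\<^sup>2 \<partial>M)"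
proof -
  have "integrable M (\<lambda>x. a x * p x + b x * p x - p x * p x)"
    by (intro Bochner_Integration.integrable_add Bochner_Integration.integrable_diff
        integrable_mult_square sq) auto
  then have i: "integrable M (\<lambda>x. (a x + b x - p x) * p x)"
    by (simp add: algebra_simps)
  have "(\<integral>x. (p x)\<^sup>2 \<partial>M)
      \<le> (\<integral>x. 2 * (a x)\<^sup>2 + 2 * (b x)\<^sup>2 - 2 * ((a x + b x - p x) * p x) \<partial>M)"
  proof (rule integral_mono)
    fix x
    show "(p x)\<^sup>2 \<le> 2 * (a x)\<^sup>2 + 2 * (b x)\<^sup>2 - 2 * ((a x + b x - p x) * p x)"
      using zero_le_power2[of "a x + b x - p x"] zero_le_power2[of "a x - b x"]
      by (simp add: power2_eq_square algebra_simps)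
  qed (use sq i in auto)
  also have "\<dots> = 2 * (\<integral>x. (a x)\<^sup>2 \<partial>M) + 2 * (\<integral>x. (b x)\<^sup>2 \<partial>M)"
    using sq i orth by simp
  finally show ?thesis .
qed

lemma weak_deriv_test_eq:
  assumes "weak_deriv U D u g" "weak_deriv U D u g'" "test_fun U f"
  shows "(\<integral>x. g x * f x \<partial>lebesgue_on U) = (\<integral>x. g' x * f x \<partial>lebesgue_on U)"
  using assms unfolding weak_deriv_def by (metis neg_equal_iff_equal)

locale weight =
  fixes h :: "real \<Rightarrow> real"
  assumes bounded: "bounded (h ` {0..1})"
    and pos: "\<And>t. t \<in> {0<..1} \<Longrightarrow> h t > 0"
    and cont: "continuous_on {0<..1} h"
begin

lemma continuous_on_Omega: "continuous_on Omega (\<lambda>x. h (fst x))"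
  by (rule continuous_on_compose2[OF cont]) (auto simp: Omega_def intro: continuous_intros)

lemma measurable_h [measurable]: "(\<lambda>x. h (fst x)) \<in> borel_measurable (lebesgue_on Omega)"
  by (rule continuous_imp_measurable_on_sets_lebesgue[OF continuous_on_Omega Omega_sets])

lemma pos_Omega: "x \<in> Omega \<Longrightarrow> h (fst x) > 0"
  using pos by (auto simp: Omega_def)

lemma test_fun_weighted_square:
  assumes f: "test_fun Omega f"
  shows "(\<lambda>x. sqrt (h (fst x)) * f x) \<in> borel_measurable (lebesgue_on Omega)"
    "integrable (lebesgue_on Omega) (\<lambda>x. (sqrt (h (fst x)) * f x)\<^sup>2)"
proof -
  note [measurable] = test_fun_square(1)[OF f]
  show meas [measurable]: "(\<lambda>x. sqrt (h (fst x)) * f x) \<in> borel_measurable (lebesgue_on Omega)"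
    by measurable
  obtain B where B: "\<And>t. t \<in> {0..1} \<Longrightarrow> \<bar>h t\<bar> \<le> B"
    using bounded unfolding bounded_iff by (metis image_eqI real_norm_def)
  show "integrable (lebesgue_on Omega) (\<lambda>x. (sqrt (h (fst x)) * f x)\<^sup>2)"
  proof (rule Bochner_Integration.integrable_bound)
    show "integrable (lebesgue_on Omega) (\<lambda>x. B * (f x)\<^sup>2)"
      using test_fun_square(2)[OF f] by simp
    have "norm ((sqrt (h (fst x)) * f x)\<^sup>2) \<le> norm (B * (f x)\<^sup>2)" if "x \<in> Omega" for x
    proof -
      have "h (fst x) \<le> B"
        using B[of "fst x"] that by (auto simp: Omega_def)
      then have "h (fst x) * (f x)\<^sup>2 \<le> B * (f x)\<^sup>2"
        by (intro mult_right_mono) auto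
      then show ?thesis
        using pos_Omega[OF that] \<open>h (fst x) \<le> B\<close> by (simp add: power_mult_distrib abs_mult)
    qed
    then show "AE x in lebesgue_on Omega. norm ((sqrt (h (fst x)) * f x)\<^sup>2) \<le> norm (B * (f x)\<^sup>2)"
      by (intro AE_I2) simp
  qed measurable
qed

text \<open>The product of \<open>h\<close> with a test function is in general not a test function, since \<open>h\<close> is only
  continuous; approximating \<open>h\<close> by polynomials on the support remedies this.\<close>

lemma weighted_orthogonal:
  assumes g: "weak_deriv Omega D u g" and g': "weak_deriv Omega D u g'" and f: "test_fun Omega f"
  shows "(\<integral>x. (g x - g' x) * (h (fst x) * f x) \<partial>lebesgue_on Omega) = 0"
proof -
  define K where "K = closure {x. f x \<noteq> 0}"
  have K: "compact K" "K \<subseteq> Omega" and Kf: "\<And>x. x \<notin> K \<Longrightarrow> f x = 0"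
    using f closure_subset[of "{x. f x \<noteq> 0}"] by (auto simp: K_def test_fun_def)
  define d where "d x = g x - g' x" for x
  have loc: "loc_int Omega g" "loc_int Omega g'"
    using g g' by (auto simp: weak_deriv_def)
  then have locd: "loc_int Omega d"
    unfolding loc_int_def d_def by (auto intro: Bochner_Integration.integrable_diff)
  have cf: "continuous_on S f" for S
    by (intro smooth_R2_continuous_on test_fun_smooth[OF f])
  note [measurable] = test_fun_square(1)[OF f]
  have ch: "continuous_on (fst ` K) h"
    using K by (intro continuous_on_subset[OF cont]) (auto simp: Omega_def)
  have cK: "compact (fst ` K)"
    by (intro compact_continuous_image continuous_intros K)
  obtain B where B: "\<And>x. x \<in> K \<Longrightarrow> \<bar>f x\<bar> \<le> B"
    using compact_imp_bounded[OF compact_continuous_image[OF cf K(1)]] by (auto simp: bounded_iff)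
  define I where "I = (\<integral>x. \<bar>d x\<bar> \<partial>lebesgue_on K)"
  have "I \<ge> 0" unfolding I_def by simp
  have est: "\<bar>\<integral>x. d x * (h (fst x) * f x) \<partial>lebesgue_on Omega\<bar> \<le> e * (\<bar>B\<bar> * I)" if "e > 0" for e
  proof -
    \<comment> \<open>The projection of the support is a compact subset of the open unit interval,
      where \<open>h\<close> is continuous, so Weierstrass approximation applies.\<close>
    obtain P where P: "real_polynomial_function P" and Ph: "\<And>t. t \<in> fst ` K \<Longrightarrow> \<bar>h t - P t\<bar> < e"
      using Stone_Weierstrass_real_polynomial_function[OF cK ch \<open>e > 0\<close>] by metis
    define w where "w x = P (fst x) * f x" for x
    have w: "test_fun Omega w"
      unfolding w_def by (rule test_fun_polynomial_mult[OF P f])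
    note [measurable] = test_fun_square(1)[OF w]
    have cw: "continuous_on S w" for S
      by (intro smooth_R2_continuous_on test_fun_smooth[OF w])
    obtain B' where B': "\<And>x. x \<in> K \<Longrightarrow> \<bar>w x\<bar> \<le> B'"
      using compact_imp_bounded[OF compact_continuous_image[OF cw K(1)]] by (auto simp: bounded_iff)
    have Kw: "\<And>x. x \<in> Omega - K \<Longrightarrow> w x = 0"
      by (simp add: w_def Kf)
    note int = integrable_mult_compact_support(1)[OF _ K _ Kw B']
    have d0: "(\<integral>x. d x * w x \<partial>lebesgue_on Omega) = 0"
      using weak_deriv_test_eq[OF g g' w] int[OF loc(1)] int[OF loc(2)]
      by (simp add: d_def left_diff_distrib)
    have wt: "\<bar>h (fst x) * f x - w x\<bar> \<le> e * \<bar>B\<bar>" if "x \<in> K" for x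
    proof -
      have "\<bar>h (fst x) - P (fst x)\<bar> * \<bar>f x\<bar> \<le> e * \<bar>B\<bar>"
        using Ph[of "fst x"] B[OF that] that \<open>e > 0\<close> by (intro mult_mono) auto
      then show ?thesis
        by (simp add: w_def left_diff_distrib flip: abs_mult)
    qed
    have m: "(\<lambda>x. h (fst x) * f x - w x) \<in> borel_measurable (lebesgue_on Omega)"
      by measurable
    have z: "\<And>x. x \<in> Omega - K \<Longrightarrow> h (fst x) * f x - w x = 0"
      by (simp add: w_def Kf)
    note r = integrable_mult_compact_support[OF locd K m z wt]
    have "(\<integral>x. d x * (h (fst x) * f x) \<partial>lebesgue_on Omega)
        = (\<integral>x. d x * (h (fst x) * f x - w x) + d x * w x \<partial>lebesgue_on Omega)"
      by (simp add: algebra_simps)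
    also have "\<dots> = (\<integral>x. d x * (h (fst x) * f x - w x) \<partial>lebesgue_on Omega)
        + (\<integral>x. d x * w x \<partial>lebesgue_on Omega)"
      using r(1) int[OF locd] by (intro Bochner_Integration.integral_add) auto
    finally show ?thesis
      using r(2) d0 by (simp add: I_def mult.assoc)
  qed
  have "\<bar>\<integral>x. d x * (h (fst x) * f x) \<partial>lebesgue_on Omega\<bar> \<le> 0"
  proof (rule field_le_epsilon)
    fix e :: real assume "e > 0"
    \<comment> \<open>The added 1 covers \<open>\<bar>B\<bar> * I = 0\<close>; the absolute value is
      there because \<open>B\<close> could be negative when \<open>K\<close> is empty.\<close>
    have "e / (\<bar>B\<bar> * I + 1) * (\<bar>B\<bar> * I) \<le> e"
      using \<open>e > 0\<close> \<open>I \<ge> 0\<close> by (simp add: field_simps add_pos_nonneg add_nonneg_pos)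
    then show "\<bar>\<integral>x. d x * (h (fst x) * f x) \<partial>lebesgue_on Omega\<bar> \<le> 0 + e"
      using est[of "e / (\<bar>B\<bar> * I + 1)"] \<open>e > 0\<close> \<open>I \<ge> 0\<close> by (simp add: add_nonneg_pos)
  qed
  then show ?thesis by (simp add: d_def)
qed

text \<open>Testing the weak derivatives with the derivatives of \<open>f\<close> itself controls \<open>f\<close> by an arbitrary
  choice \<open>g1\<close>, \<open>g2\<close> of weak derivatives, without appealing to their uniqueness.\<close>

lemma test_fun_derivative_bound:
  assumes g: "H1h h u g1 g2" and g': "H1h h u g1' g2'" and f: "test_fun Omega f"
  shows "(\<integral>x. (pd1 f x)\<^sup>2 \<partial>lebesgue_on Omega) \<le> 2 * (\<integral>x. (pd1 f x - g1' x)\<^sup>2 \<partial>lebesgue_on Omega)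
      + 2 * (\<integral>x. (g1 x)\<^sup>2 \<partial>lebesgue_on Omega)" (is ?A)
    and "(\<integral>x. (sqrt (h (fst x)) * pd2 f x)\<^sup>2 \<partial>lebesgue_on Omega)
      \<le> 2 * (\<integral>x. (sqrt (h (fst x)) * (pd2 f x - g2' x))\<^sup>2 \<partial>lebesgue_on Omega)
      + 2 * (\<integral>x. (sqrt (h (fst x)) * g2 x)\<^sup>2 \<partial>lebesgue_on Omega)" (is ?B)
proof -
  let ?M = "lebesgue_on Omega"
  let ?s = "\<lambda>x::real\<times>real. sqrt (h (fst x))"
  note p1 = test_fun_pd(1)[OF f] and p2 = test_fun_pd(2)[OF f]
  have m [measurable]: "g1 \<in> borel_measurable ?M" "g1' \<in> borel_measurable ?M"
      "(\<lambda>x. ?s x * g2 x) \<in> borel_measurable ?M" "(\<lambda>x. ?s x * g2' x) \<in> borel_measurable ?M"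
    and i: "integrable ?M (\<lambda>x. (g1 x)\<^sup>2)" "integrable ?M (\<lambda>x. (g1' x)\<^sup>2)"
      "integrable ?M (\<lambda>x. (?s x * g2 x)\<^sup>2)" "integrable ?M (\<lambda>x. (?s x * g2' x)\<^sup>2)"
    and w: "weak_deriv Omega pd1 u g1" "weak_deriv Omega pd1 u g1'"
      "weak_deriv Omega pd2 u g2" "weak_deriv Omega pd2 u g2'"
    using g g' by (auto simp: H1h_def L2_def)
  note [measurable] = test_fun_square(1)[OF p1] test_fun_weighted_square(1)[OF p2]
  show ?A
  \<comment> \<open>Here \<open>a = pd1 f - g1'\<close>, \<open>b = g1\<close> and
    \<open>p = pd1 f\<close>, so \<open>a + b - p\<close> is the difference \<open>g1 - g1'\<close>
    of two weak derivatives, paired with the test function \<open>pd1 f\<close>.\<close>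
  proof (rule L2_bound_of_orthogonal)
    have "integrable ?M (\<lambda>x. g1 x * pd1 f x)" "integrable ?M (\<lambda>x. g1' x * pd1 f x)"
      by (intro integrable_mult_square i test_fun_square[OF p1]; measurable)+
    then show "(\<integral>x. (pd1 f x - g1' x + g1 x - pd1 f x) * pd1 f x \<partial>?M) = 0"
      using weak_deriv_test_eq[OF w(1,2) p1] by (simp add: left_diff_distrib)
    show "integrable ?M (\<lambda>x. (pd1 f x - g1' x)\<^sup>2)"
      by (intro integrable_square_diff i test_fun_square[OF p1]) measurable
  qed (use i test_fun_square[OF p1] in auto)
  \<comment> \<open>Differences are taken after weighting, since \<open>H1h\<close> provides square
    integrability only for the product with \<open>g2'\<close>.\<close>
  have eq: "(?s x * (pd2 f x - g2' x)) = ?s x * pd2 f x - ?s x * g2' x" for x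
    by (simp add: right_diff_distrib)
  show ?B
  proof (rule L2_bound_of_orthogonal)
    have "(\<integral>x. (?s x * (pd2 f x - g2' x) + ?s x * g2 x - ?s x * pd2 f x) * (?s x * pd2 f x) \<partial>?M)
       = (\<integral>x. (g2 x - g2' x) * (h (fst x) * pd2 f x) \<partial>?M)"
    proof (rule Bochner_Integration.integral_cong)
      fix x assume "x \<in> space ?M"
      then have "h (fst x) = ?s x * ?s x"
        using pos_Omega[of x] by simp
      then show "(?s x * (pd2 f x - g2' x) + ?s x * g2 x - ?s x * pd2 f x) * (?s x * pd2 f x)
         = (g2 x - g2' x) * (h (fst x) * pd2 f x)"
        by algebra
    qed simp
    also have "\<dots> = 0"
      by (rule weighted_orthogonal[OF w(3,4) p2])
    finally show "(\<integral>x. (?s x * (pd2 f x - g2' x) + ?s x * g2 x - ?s x * pd2 f x) * (?s x * pd2 f x) \<partial>?M) = 0" .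
    show "integrable ?M (\<lambda>x. (?s x * (pd2 f x - g2' x))\<^sup>2)"
      unfolding eq by (intro integrable_square_diff i test_fun_weighted_square[OF p2]) measurable
    show "(\<lambda>x. ?s x * (pd2 f x - g2' x)) \<in> borel_measurable ?M"
      unfolding eq by measurable
  qed (use i test_fun_weighted_square[OF p2] in auto)
qed

text \<open>The grid estimate in terms of the weighted energy: right of the strip,
  \<open>c \<le> h\<close> trades the plain x2-derivative for the weighted one at the price of
  \<open>1 / c\<close>.\<close>

lemma test_fun_L2_le_cells:
  assumes f: "test_fun Omega f" and K: "0 < K" and m: "0 < m" and c: "c > 0"
    and hc: "\<And>t. t \<in> {1 / real K..1} \<Longrightarrow> c \<le> h t"
    and D1: "(\<integral>x. (pd1 f x)\<^sup>2 \<partial>lebesgue_on Omega) \<le> D"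
    and D2: "(\<integral>x. (sqrt (h (fst x)) * pd2 f x)\<^sup>2 \<partial>lebesgue_on Omega) \<le> D"
  shows "(\<integral>x. (f x)\<^sup>2 \<partial>lebesgue_on Omega) \<le> (1 / real K)\<^sup>2 * D
     + (real (K * m))\<^sup>2 * (\<Sum>i<K * m. \<Sum>j<K * m. (integral (cell (K * m) i j) f)\<^sup>2)
     + 2 / (real (K * m))\<^sup>2 * (D + D / c)"
proof -
  let ?M = "lebesgue_on Omega" and ?R = "cbox (1 / real K, 0) (1, 1) :: (real \<times> real) set"
  let ?Q = "cbox (0, 0) (1, 1) :: (real \<times> real) set"
  note p1 = test_fun_pd(1)[OF f] and p2 = test_fun_pd(2)[OF f]
  have c1: "continuous_on S (\<lambda>x. (pd1 f x)\<^sup>2)" and c2: "continuous_on S (\<lambda>x. (pd2 f x)\<^sup>2)" for S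
    by (intro continuous_intros smooth_R2_continuous_on test_fun_smooth[OF p1] test_fun_smooth[OF p2])+
  have "0 \<le> t" if "1 / real K \<le> t" for t
    using order_trans[OF _ that, of 0] by simp
  then have RQ: "?R \<subseteq> ?Q"
    by auto
  have R1: "integral ?R (\<lambda>x. (pd1 f x)\<^sup>2) \<le> D"
  proof -
    have "integral ?R (\<lambda>x. (pd1 f x)\<^sup>2) \<le> integral ?Q (\<lambda>x. (pd1 f x)\<^sup>2)"
      by (intro integral_subset_le integrable_continuous c1 RQ) auto
    then show ?thesis using D1 test_fun_square(3)[OF p1] by simp
  qed
  have R2: "integral ?R (\<lambda>x. (pd2 f x)\<^sup>2) \<le> D / c"
  proof -
    have RO: "?R \<inter> Omega \<in> sets lebesgue"
      using Omega_sets by auto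
    have "integral ?R (\<lambda>x. (pd2 f x)\<^sup>2) = (\<integral>x. (pd2 f x)\<^sup>2 \<partial>lebesgue_on ?R)"
      by (intro lebesgue_integral_eq_integral[symmetric] continuous_imp_integrable c2) auto
    \<comment> \<open>The closed rectangle reaches the boundary of \<open>Omega\<close>, where
      \<open>pd2 f\<close> vanishes; the indicator then moves the integral to all of
      \<open>Omega\<close>, where the weighted energy lives.\<close>
    also have "\<dots> = (\<integral>x. (pd2 f x)\<^sup>2 \<partial>lebesgue_on (?R \<inter> Omega))"
      by (rule lebesgue_on_support) (use RO test_fun_eq_0[OF p2] in auto)
    also have "\<dots> = (\<integral>x. indicator (?R \<inter> Omega) x * (pd2 f x)\<^sup>2 \<partial>lebesgue_on (?R \<inter> Omega))"
      by (intro Bochner_Integration.integral_cong) (auto simp: indicator_def)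
    also have "\<dots> = (\<integral>x. indicator (?R \<inter> Omega) x * (pd2 f x)\<^sup>2 \<partial>?M)"
      by (rule lebesgue_on_support(2)[symmetric]) (use RO Omega_sets in \<open>auto simp: indicator_def\<close>)
    also have "\<dots> \<le> (\<integral>x. (sqrt (h (fst x)) * pd2 f x)\<^sup>2 / c \<partial>?M)"
    proof (rule integral_mono')
      show "integrable ?M (\<lambda>x. (sqrt (h (fst x)) * pd2 f x)\<^sup>2 / c)"
        using test_fun_weighted_square(2)[OF p2] by simp
      fix x assume "x \<in> space ?M"
      then have x: "x \<in> Omega" by simp
      show "0 \<le> (sqrt (h (fst x)) * pd2 f x)\<^sup>2 / c"
        using c by simp
      then show "indicator (?R \<inter> Omega) x * (pd2 f x)\<^sup>2 \<le> (sqrt (h (fst x)) * pd2 f x)\<^sup>2 / c"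
      proof (cases "x \<in> ?R")
        case True
        then have "c \<le> h (fst x)"
          using hc[of "fst x"] by (cases x) auto
        then have "c * (pd2 f x)\<^sup>2 \<le> h (fst x) * (pd2 f x)\<^sup>2"
          by (intro mult_right_mono) auto
        then show ?thesis
          using True x c pos_Omega[OF x] by (simp add: power_mult_distrib field_simps)
      qed (simp add: indicator_def)
    qed
    also have "\<dots> = (\<integral>x. (sqrt (h (fst x)) * pd2 f x)\<^sup>2 \<partial>?M) / c"
      by simp
    also have "\<dots> \<le> D / c"
      using D2 c by (simp add: divide_right_mono)
    finally show ?thesis .
  qed
  have z: "f (0, y) = 0" for y
    using test_fun_eq_0[OF f] by (simp add: Omega_def)
  have "(\<integral>x. (f x)\<^sup>2 \<partial>?M) \<le> (1 / real K)\<^sup>2 * integral ?Q (\<lambda>x. (pd1 f x)\<^sup>2)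
     + (real (K * m))\<^sup>2 * (\<Sum>i<K * m. \<Sum>j<K * m. (integral (cell (K * m) i j) f)\<^sup>2)
     + 2 / (real (K * m))\<^sup>2 * integral ?R (\<lambda>x. (pd1 f x)\<^sup>2 + (pd2 f x)\<^sup>2)"
    unfolding test_fun_square(3)[OF f] by (rule L2_le_cells[OF test_fun_smooth[OF f] z K m])
  also have "integral ?R (\<lambda>x. (pd1 f x)\<^sup>2 + (pd2 f x)\<^sup>2)
     = integral ?R (\<lambda>x. (pd1 f x)\<^sup>2) + integral ?R (\<lambda>x. (pd2 f x)\<^sup>2)"
    by (intro integral_add integrable_continuous c1 c2)
  finally show ?thesis
    using D1 R1 R2 unfolding test_fun_square(3)[OF p1]
    by (smt (verit, best) divide_nonneg_nonneg mult_left_mono zero_le_power2)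
qed

end

section \<open>Extraction of a convergent subsequence\<close>

lemma (in weight) compact_embedding: "compact_embedding_H0_L2 h"
  unfolding compact_embedding_H0_L2_def
proof (intro allI impI)
  fix u :: "nat \<Rightarrow> real \<times> real \<Rightarrow> real" and g1 g2 :: "nat \<Rightarrow> real \<times> real \<Rightarrow> real" and M :: real
  assume asm: "\<forall>n. H0 h (u n) \<and> H1h h (u n) (g1 n) (g2 n) \<and> Hnorm2 h (u n) (g1 n) (g2 n) \<le> M"
  let ?M = "lebesgue_on Omega"
  let ?s = "\<lambda>x::real\<times>real. sqrt (h (fst x))"
  \<comment> \<open>Bounds \<open>2 * (error) + 2 * (norm)\<close> with approximation error at most
    1 and squared norm at most \<open>M\<close>.\<close>
  define D0 where "D0 = 2 + 2 * M"
  have u [measurable]: "u n \<in> borel_measurable ?M" and usq: "integrable ?M (\<lambda>x. (u n x)\<^sup>2)" for n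
    using asm by (auto simp: H1h_def L2_def)
  define approx where "approx n f \<longleftrightarrow> test_fun Omega f \<and> (\<integral>x. (u n x - f x)\<^sup>2 \<partial>?M) \<le> inverse (real (Suc n))
     \<and> (\<integral>x. (f x)\<^sup>2 \<partial>?M) \<le> D0 \<and> (\<integral>x. (pd1 f x)\<^sup>2 \<partial>?M) \<le> D0
     \<and> (\<integral>x. (?s x * pd2 f x)\<^sup>2 \<partial>?M) \<le> D0" for n f
  have "\<exists>f. approx n f" for n
  proof -
    obtain g1' g2' f where g': "H1h h (u n) g1' g2'" and f: "\<And>k. test_fun Omega (f k)"
      and lim: "(\<lambda>k. Hnorm2 h (\<lambda>x. f k x - u n x) (\<lambda>x. pd1 (f k) x - g1' x) (\<lambda>x. pd2 (f k) x - g2' x))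
          \<longlonglongrightarrow> 0"
      using asm unfolding H0_def by meson
    have g: "H1h h (u n) (g1 n) (g2 n)" "Hnorm2 h (u n) (g1 n) (g2 n) \<le> M"
      using asm by auto
    have "0 < inverse (real (Suc n))" by simp
    from order_tendstoD(2)[OF lim this] obtain k where
      k: "Hnorm2 h (\<lambda>x. f k x - u n x) (\<lambda>x. pd1 (f k) x - g1' x) (\<lambda>x. pd2 (f k) x - g2' x)
         < inverse (real (Suc n))"
      by (auto simp: eventually_sequentially)
    have nn: "0 \<le> (\<integral>x. (w x)\<^sup>2 \<partial>?M)" for w :: "real \<times> real \<Rightarrow> real"
      by simp
    have small: "inverse (real (Suc n)) \<le> 1"
      by (simp add: field_simps)
    have b: "(\<integral>x. (u n x)\<^sup>2 \<partial>?M) \<le> M" "(\<integral>x. (g1 n x)\<^sup>2 \<partial>?M) \<le> M" "(\<integral>x. (?s x * g2 n x)\<^sup>2 \<partial>?M) \<le> M"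
      using g(2) nn[of "u n"] nn[of "g1 n"] nn[of "\<lambda>x. ?s x * g2 n x"] unfolding Hnorm2_def by linarith+
    have e: "(\<integral>x. (f k x - u n x)\<^sup>2 \<partial>?M) \<le> inverse (real (Suc n))"
      "(\<integral>x. (pd1 (f k) x - g1' x)\<^sup>2 \<partial>?M) \<le> inverse (real (Suc n))"
      "(\<integral>x. (?s x * (pd2 (f k) x - g2' x))\<^sup>2 \<partial>?M) \<le> inverse (real (Suc n))"
      using k nn[of "\<lambda>x. f k x - u n x"] nn[of "\<lambda>x. pd1 (f k) x - g1' x"]
        nn[of "\<lambda>x. ?s x * (pd2 (f k) x - g2' x)"] unfolding Hnorm2_def by linarith+
    note fk = test_fun_square[OF f[of k]]
    have "(\<integral>x. (f k x)\<^sup>2 \<partial>?M) \<le> 2 * (\<integral>x. (f k x - u n x)\<^sup>2 \<partial>?M) + 2 * (\<integral>x. (u n x)\<^sup>2 \<partial>?M)"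
      using fk u usq by (intro L2_bound_of_orthogonal integrable_square_diff) auto
    moreover have "(\<integral>x. (u n x - f k x)\<^sup>2 \<partial>?M) = (\<integral>x. (f k x - u n x)\<^sup>2 \<partial>?M)"
      by (simp add: power2_commute)
    ultimately show ?thesis
      using test_fun_derivative_bound[OF g(1) g' f[of k]] b e small
      by (intro exI[of _ "f k"]) (auto simp: f D0_def approx_def)
  qed
  then obtain f where "\<And>n. approx n (f n)"
    by metis
  then have f: "\<And>n. test_fun Omega (f n)"
    and uf: "\<And>n. (\<integral>x. (u n x - f n x)\<^sup>2 \<partial>?M) \<le> inverse (real (Suc n))"
    and f0: "\<And>n. (\<integral>x. (f n x)\<^sup>2 \<partial>?M) \<le> D0"
    and f1: "\<And>n. (\<integral>x. (pd1 (f n) x)\<^sup>2 \<partial>?M) \<le> D0"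
    and f2: "\<And>n. (\<integral>x. (?s x * pd2 (f n) x)\<^sup>2 \<partial>?M) \<le> D0"
    by (simp_all add: approx_def)
  note fsq = test_fun_square[OF f]
  have cf: "continuous_on S (f n)" for S n
    by (intro smooth_R2_continuous_on test_fun_smooth[OF f])
  have D0: "0 \<le> D0"
    using f0[of 0] by (rule order_trans[rotated]) simp
  \<comment> \<open>Cells of all grids together: a countable index set, so one diagonal argument
    yields a subsequence that does not depend on the accuracy \<open>e\<close>.\<close>
  define S where "S = {(N, i, j). i < N \<and> j < (N::nat)}"
  define a where "a n = (\<lambda>(N, i, j). integral (cell N i j) (f n))" for n
  have "norm (a n p) \<le> 1 + D0" if pS: "p \<in> S" for n p
  proof -
    obtain N i j where p: "p = (N, i, j)" and ij: "i < N" "j < N"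
      using pS by (auto simp: S_def)
    let ?Q = "cbox (0, 0) (1, 1) :: (real \<times> real) set"
    have unit: "{real k / real N..real k / real N + 1 / real N} \<subseteq> {0..1}" if "k < N" for k
    proof -
      have "real k + 1 \<le> real N"
        using that by linarith
      then have "real k / real N + 1 / real N \<le> 1"
        using that by (simp add: add_divide_distrib[symmetric])
      then show ?thesis by simp
    qed
    have sub: "cell N i j \<subseteq> ?Q"
      using unit[OF ij(1)] unit[OF ij(2)] unfolding cell_def cbox_Pair_eq box_real by (rule Sigma_mono)
    have ci: "continuous_on T (\<lambda>x. 1 + (f n x)\<^sup>2)" for T
      by (intro continuous_intros cf)
    have "norm (integral (cell N i j) (f n)) \<le> integral (cell N i j) (\<lambda>x. 1 + (f n x)\<^sup>2)"
    proof (rule integral_norm_bound_integral)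
      \<comment> \<open>Over the unit square, of area 1, this gives a bound independent of the cell
        and of \<open>n\<close>.\<close>
      show "norm (f n x) \<le> 1 + (f n x)\<^sup>2" for x
        using zero_le_power2[of "\<bar>f n x\<bar> - 1"] abs_ge_zero[of "f n x"]
        unfolding power2_diff power2_abs real_norm_def one_power2 by linarith
    qed (use cf ci in \<open>auto simp: cell_def intro!: integrable_continuous\<close>)
    also have "\<dots> \<le> integral ?Q (\<lambda>x. 1 + (f n x)\<^sup>2)"
      using sub ci unfolding cell_def
      by (intro integral_subset_le integrable_continuous) auto
    also have "\<dots> = 1 + integral ?Q (\<lambda>x. (f n x)\<^sup>2)"
      by (subst integral_add) (auto intro!: integrable_continuous continuous_intros cf simp: content_Pair)
    also have "\<dots> \<le> 1 + D0"
      using f0[of n] fsq(3)[of n] by simp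
    finally show ?thesis by (simp add: a_def p)
  qed
  then obtain r where r: "strict_mono (r::nat\<Rightarrow>nat)"
    and conv: "\<And>p. p \<in> S \<Longrightarrow> \<exists>l. (\<lambda>n. a (r n) p) \<longlonglongrightarrow> l"
    using function_convergent_subsequence[of S a "1 + D0"] by (metis countableI_type)
  obtain l where l: "\<And>p. p \<in> S \<Longrightarrow> (\<lambda>n. a (r n) p) \<longlonglongrightarrow> l p"
    using conv by metis
  \<comment> \<open>Energy bound for a difference of two approximants: twice \<open>D0\<close> for
    each of them.\<close>
  define D where "D = 4 * D0"
  have Cauchy: "\<exists>n0. \<forall>m\<ge>n0. \<forall>n\<ge>n0. (\<integral>x. (f (r m) x - f (r n) x)\<^sup>2 \<partial>?M) \<le> e" if e: "e > 0" for e
  proof -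
    have large: "\<exists>k::nat. 0 < k \<and> b / real k \<le> e / 3" for b :: real
    proof -
      obtain k :: nat where "3 * b / e < real k"
        using reals_Archimedean2 by blast
      then have "3 * b < e * real (Suc k)"
        using e by (simp add: field_simps add_strict_increasing)
      then have "b / real (Suc k) \<le> e / 3"
        by (simp add: field_simps)
      then show ?thesis by blast
    qed
    obtain K :: nat where K: "0 < K" "D / real K \<le> e / 3"
      using large by blast
    have sub: "{1 / real K..1} \<subseteq> {0<..1}"
    proof
      fix t assume "t \<in> {1 / real K..1}"
      moreover have "0 < 1 / real K" using K by simp
      ultimately show "t \<in> {0<..1}"
        unfolding atLeastAtMost_iff greaterThanAtMost_iff by linarith
    qed
    obtain t0 where t0: "t0 \<in> {1 / real K..1}" "\<And>t. t \<in> {1 / real K..1} \<Longrightarrow> h t0 \<le> h t"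
      using continuous_attains_inf[OF _ _ continuous_on_subset[OF cont sub]] K by auto
    have c: "h t0 > 0"
      using t0(1) sub by (intro pos) blast
    \<comment> \<open>The refinement is chosen after the minimum \<open>h t0\<close>, which depends
      on \<open>K\<close>.\<close>
    obtain m :: nat where m: "0 < m" "2 * (D + D / h t0) / real m \<le> e / 3"
      using large by blast
    define N where "N = K * m"
    \<comment> \<open>Twice the squared distance of the cell integrals to their limits, weighted as
      in the grid estimate. Going through the limits \<open>l\<close> bounds the cell term for two
      indices by \<open>\<sigma> p + \<sigma> q\<close>, hence the threshold \<open>e / 6\<close>
      below.\<close>
    define \<sigma> where "\<sigma> n = (real N)\<^sup>2 * (\<Sum>i<N. \<Sum>j<N. 2 * (a (r n) (N, i, j) - l (N, i, j))\<^sup>2)" for n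
    have "\<sigma> \<longlonglongrightarrow> (real N)\<^sup>2 * (\<Sum>i<N. \<Sum>j<N. 2 * (l (N, i, j) - l (N, i, j))\<^sup>2)"
      unfolding \<sigma>_def by (intro tendsto_intros l) (auto simp: S_def)
    then have "\<sigma> \<longlonglongrightarrow> 0" by simp
    from order_tendstoD(2)[OF this, of "e / 6"] obtain n0 where n0: "\<And>n. n \<ge> n0 \<Longrightarrow> \<sigma> n < e / 6"
      using e by (auto simp: eventually_sequentially)
    have "(\<integral>x. (f (r p) x - f (r q) x)\<^sup>2 \<partial>?M) \<le> e" if pq: "p \<ge> n0" "q \<ge> n0" for p q
    proof -
      define \<phi> where "\<phi> x = f (r p) x - f (r q) x" for x
      have t\<phi>: "test_fun Omega \<phi>"
        unfolding \<phi>_def by (intro test_fun_diff f)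
      have d\<phi>: "pd1 \<phi> = (\<lambda>x. pd1 (f (r p)) x - pd1 (f (r q)) x)" "pd2 \<phi> = (\<lambda>x. pd2 (f (r p)) x - pd2 (f (r q)) x)"
        unfolding \<phi>_def by (intro pd_diff test_fun_smooth[OF f])+
      note P1 = test_fun_square(1,2)[OF test_fun_pd(1)[OF f]]
        test_fun_square(1,2)[OF test_fun_pd(1)[OF t\<phi>]]
      note P2 = test_fun_weighted_square[OF test_fun_pd(2)[OF f]]
        test_fun_weighted_square[OF test_fun_pd(2)[OF t\<phi>]]
      \<comment> \<open>With \<open>b\<close> the negated second derivative,
        \<open>a + b - p\<close> is identically zero, so orthogonality is trivial.\<close>
      have "(\<integral>x. (pd1 \<phi> x)\<^sup>2 \<partial>?M) \<le> 2 * (\<integral>x. (pd1 (f (r p)) x)\<^sup>2 \<partial>?M) + 2 * (\<integral>x. (- pd1 (f (r q)) x)\<^sup>2 \<partial>?M)"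
        using P1 by (intro L2_bound_of_orthogonal) (auto simp: d\<phi>)
      then have D1: "(\<integral>x. (pd1 \<phi> x)\<^sup>2 \<partial>?M) \<le> D"
        using f1[of "r p"] f1[of "r q"] by (simp add: D_def)
      have "(\<integral>x. (?s x * pd2 \<phi> x)\<^sup>2 \<partial>?M) \<le> 2 * (\<integral>x. (?s x * pd2 (f (r p)) x)\<^sup>2 \<partial>?M)
          + 2 * (\<integral>x. (- (?s x * pd2 (f (r q)) x))\<^sup>2 \<partial>?M)"
        using P2 by (intro L2_bound_of_orthogonal) (auto simp: d\<phi> right_diff_distrib)
      then have D2: "(\<integral>x. (?s x * pd2 \<phi> x)\<^sup>2 \<partial>?M) \<le> D"
        using f2[of "r p"] f2[of "r q"] by (simp add: D_def)
      have main: "(\<integral>x. (\<phi> x)\<^sup>2 \<partial>?M) \<le> (1 / real K)\<^sup>2 * D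
         + (real N)\<^sup>2 * (\<Sum>i<N. \<Sum>j<N. (integral (cell N i j) \<phi>)\<^sup>2)
         + 2 / (real N)\<^sup>2 * (D + D / h t0)"
        unfolding N_def by (rule test_fun_L2_le_cells[OF t\<phi> K(1) m(1) c t0(2) D1 D2])
      have Dnn: "0 \<le> D" "0 \<le> D + D / h t0"
        using D0 c by (auto simp: D_def)
      have sq_le: "(1 / real k)\<^sup>2 \<le> 1 / real k" if "0 < k" for k :: nat
        using that by (simp add: power2_eq_square field_simps)
      have "(1 / real K)\<^sup>2 * D \<le> 1 / real K * D"
        using K(1) Dnn by (intro mult_right_mono sq_le) auto
      then have e1: "(1 / real K)\<^sup>2 * D \<le> e / 3"
        using K(2) by (simp only: times_divide_eq_left mult_1_left)
      have "2 / (real N)\<^sup>2 \<le> 2 / real m"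
      proof -
        have "real m \<le> (real N)\<^sup>2"
          unfolding N_def of_nat_power[symmetric] of_nat_le_iff
          using K(1) m(1) by (simp add: power2_eq_square)
        then show ?thesis
          using m(1) K(1) by (intro divide_left_mono) (auto simp: N_def)
      qed
      then have "2 / (real N)\<^sup>2 * (D + D / h t0) \<le> 2 / real m * (D + D / h t0)"
        using Dnn by (intro mult_right_mono) auto
      then have e3: "2 / (real N)\<^sup>2 * (D + D / h t0) \<le> e / 3"
        using m(2) by (simp only: times_divide_eq_left)
      have cells: "integral (cell N i j) \<phi> = a (r p) (N, i, j) - a (r q) (N, i, j)" for i j
        unfolding \<phi>_def a_def cell_def using cf by (auto intro!: integral_diff integrable_continuous)
      have "(integral (cell N i j) \<phi>)\<^sup>2 \<le> 2 * (a (r p) (N, i, j) - l (N, i, j))\<^sup>2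
         + 2 * (a (r q) (N, i, j) - l (N, i, j))\<^sup>2" for i j
        using zero_le_power2[of "(a (r p) (N, i, j) - l (N, i, j)) + (a (r q) (N, i, j) - l (N, i, j))"]
        unfolding cells by (simp add: power2_eq_square algebra_simps)
      then have "(\<Sum>i<N. \<Sum>j<N. (integral (cell N i j) \<phi>)\<^sup>2)
         \<le> (\<Sum>i<N. \<Sum>j<N. 2 * (a (r p) (N, i, j) - l (N, i, j))\<^sup>2 + 2 * (a (r q) (N, i, j) - l (N, i, j))\<^sup>2)"
        by (intro sum_mono) auto
      then have "(real N)\<^sup>2 * (\<Sum>i<N. \<Sum>j<N. (integral (cell N i j) \<phi>)\<^sup>2) \<le> \<sigma> p + \<sigma> q"
        unfolding \<sigma>_def distrib_left[symmetric] sum.distrib[symmetric]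
        by (intro mult_left_mono) auto
      then have "(real N)\<^sup>2 * (\<Sum>i<N. \<Sum>j<N. (integral (cell N i j) \<phi>)\<^sup>2) \<le> e / 3"
        using n0[OF pq(1)] n0[OF pq(2)] by simp
      then show ?thesis
        using main e1 e3 unfolding \<phi>_def by linarith
    qed
    then show ?thesis by blast
  qed
  obtain v where v [measurable]: "v \<in> borel_measurable ?M" and vsq: "integrable ?M (\<lambda>x. (v x)\<^sup>2)"
    and fv: "(\<lambda>n. \<integral>x. (f (r n) x - v x)\<^sup>2 \<partial>?M) \<longlonglongrightarrow> 0"
    using L2_Cauchy_imp_convergent[OF finite_measure_Omega, of "\<lambda>n. f (r n)"] fsq(1,2) Cauchy
    by blast
  have "(\<lambda>n. \<integral>x. (u (r n) x - v x)\<^sup>2 \<partial>?M) \<longlonglongrightarrow> 0"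
  proof (rule tendsto_sandwich[where f = "\<lambda>_. 0"])
    have "(\<integral>x. (u (r n) x - v x)\<^sup>2 \<partial>?M)
      \<le> 2 * inverse (real (Suc n)) + 2 * (\<integral>x. (f (r n) x - v x)\<^sup>2 \<partial>?M)" for n
    proof -
      have "(\<integral>x. (u (r n) x - v x)\<^sup>2 \<partial>?M)
        \<le> 2 * (\<integral>x. (u (r n) x - f (r n) x)\<^sup>2 \<partial>?M) + 2 * (\<integral>x. (f (r n) x - v x)\<^sup>2 \<partial>?M)"
        using fsq(1,2) u usq v vsq by (intro L2_bound_of_orthogonal integrable_square_diff) auto
      moreover have "inverse (real (Suc (r n))) \<le> inverse (real (Suc n))"
        using seq_suble[OF r, of n] by (intro le_imp_inverse_le) auto
      ultimately show ?thesis
        using uf[of "r n"] by linarith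
    qed
    then show "\<forall>\<^sub>F n in sequentially. (\<integral>x. (u (r n) x - v x)\<^sup>2 \<partial>?M)
      \<le> 2 * inverse (real (Suc n)) + 2 * (\<integral>x. (f (r n) x - v x)\<^sup>2 \<partial>?M)"
      by simp
    show "(\<lambda>n. 2 * inverse (real (Suc n)) + 2 * (\<integral>x. (f (r n) x - v x)\<^sup>2 \<partial>?M)) \<longlonglongrightarrow> 0"
      using tendsto_add[OF tendsto_mult[OF tendsto_const LIMSEQ_inverse_real_of_nat]
          tendsto_mult[OF tendsto_const fv], of 2 2] by simp
  qed (auto intro: tendsto_const)
  then show "\<exists>r v. strict_mono r \<and> L2 Omega v \<and> (\<lambda>n. \<integral>x. (u (r n) x - v x)\<^sup>2 \<partial>?M) \<longlonglongrightarrow> 0"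
    using r v vsq unfolding L2_def by blast
qed

theorem theorem3p4:
  fixes h :: "real \<Rightarrow> real" and C \<theta> :: real
  assumes "bounded (h ` {0..1})"
    and "h 0 = 0"
    and "\<forall>t\<in>{0<..1}. h t > 0"
    and "\<exists>h'. continuous_on {0<..1} h' \<and>
           (\<forall>t\<in>{0<..1}. (h has_real_derivative h' t) (at t within {0<..1}))"
    and "C > 0" and "0 < \<theta>" and "\<theta> < 1"
    and "\<forall>x\<in>Omega. \<forall>r. 0 < r \<and> r \<le> diameter Omega \<longrightarrow>
           (\<integral>\<^sup>+ y\<in>ball x r \<inter> Omega. ennreal (1 / h (fst y)) \<partial>lebesgue)
             / ennreal (measure lebesgue (ball x r \<inter> Omega) powr \<theta>) \<le> ennreal C"
  shows "compact_embedding_H0_L2 h"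
proof -
  obtain h' where h': "\<And>t. t \<in> {0<..1} \<Longrightarrow> (h has_real_derivative h' t) (at t within {0<..1})"
    using assms(4) by blast
  interpret weight h
  proof
    show "continuous_on {0<..1} h"
      using h' by (rule DERIV_continuous_on)
  qed (use assms in auto)
  show ?thesis
    by (rule compact_embedding)
qed

end
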